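(* Let $\kappa$ be a cardinal and let $\mathbb C_\kappa=\mathrm{Add}(\omega,\kappa)$ be the forcing adding $\kappa$ many Cohen reals. If $\mathcal P$ is a tight eventually different set of permutations, then $\Vdash_{\mathbb C_\kappa}$ "$\check{\mathcal P}$ is tight".
   Context: For $f,g\in\omega^\omega$, $f\neq^* g$ means there is $k<\omega$ with $f(n)\neq g(n)$ for all $n>k$. An eventually different set of permutations is a set $\mathcal P$ of bijections $\omega\to\omega$ with $f\neq^* g$ for all distinct $f,g\in\mathcal P$. A tree is a set $T\subseteq\omega^{<\omega}$ closed under initial segments and pruned; it is injective if every $t\in T$ is an injective finite function. Functions and finite sequences are identified with their graphs; for $t\in T$ let $T_t=\{s\in T: s\subseteq t\text{ or }t\subseteq s\}$. $\mathcal I_T(\mathcal P)^+$ is the set of injective trees $T$ such that for no $t\in T$ and no finite $X\subseteq\mathcal P$ is $\bigcup T_t\setminus\bigcup X$ finite. A function $g$ densely diagonalizes a tree $T$ if for every $t\in T$ there are $s\in T$, $s\supsetneq t$, and $k\in\mathrm{dom}(s)\setminus\mathrm{dom}(t)$ with $s(k)=g(k)$. $\mathcal P$ is tight if every countable family of injective trees in $\mathcal I_T(\mathcal P)^+$ is densely diagonalized by a single $g\in\mathcal P$. *)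

theory Defs
  imports "HOL-Library.Countable_Set" "HOL-Library.Sublist"
begin

section \<open>Tightness in the ground model\<close>

definition eventually_different :: "(nat \<Rightarrow> nat) \<Rightarrow> (nat \<Rightarrow> nat) \<Rightarrow> bool" where
  "eventually_different f g \<longleftrightarrow> (\<exists>k. \<forall>n>k. f n \<noteq> g n)"

definition eventually_different_permutations :: "(nat \<Rightarrow> nat) set \<Rightarrow> bool" where
  "eventually_different_permutations P \<longleftrightarrow>
     (\<forall>f\<in>P. bij f) \<and> (\<forall>f\<in>P. \<forall>g\<in>P. f \<noteq> g \<longrightarrow> eventually_different f g)"

text \<open>A finite sequence is a list \<open>t\<close> with domain \<open>{..<length t}\<close>; the empty tree is
  not excluded.\<close>

definition tree :: "nat list set \<Rightarrow> bool" where
  "tree T \<longleftrightarrow> (\<forall>t\<in>T. \<forall>s. prefix s t \<longrightarrow> s \<in> T) \<and> (\<forall>t\<in>T. \<exists>s\<in>T. strict_prefix t s)"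

definition injective_tree :: "nat list set \<Rightarrow> bool" where
  "injective_tree T \<longleftrightarrow> tree T \<and> (\<forall>t\<in>T. distinct t)"

definition graph_seq :: "nat list \<Rightarrow> (nat \<times> nat) set" where
  "graph_seq t = {(k, t ! k) | k. k < length t}"

definition graph_fun :: "(nat \<Rightarrow> nat) \<Rightarrow> (nat \<times> nat) set" where
  "graph_fun f = range (\<lambda>k. (k, f k))"

definition subtree_at :: "nat list set \<Rightarrow> nat list \<Rightarrow> nat list set" where
  "subtree_at T t = {s \<in> T. prefix s t \<or> prefix t s}"

definition positive_trees :: "(nat \<Rightarrow> nat) set \<Rightarrow> nat list set set" where
  "positive_trees P = {T. injective_tree T \<and>
     \<not> (\<exists>t\<in>T. \<exists>X. finite X \<and> X \<subseteq> P \<and>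
          finite (\<Union>(graph_seq ` subtree_at T t) - \<Union>(graph_fun ` X)))}"

definition densely_diagonalizes :: "(nat \<Rightarrow> nat) \<Rightarrow> nat list set \<Rightarrow> bool" where
  "densely_diagonalizes g T \<longleftrightarrow>
     (\<forall>t\<in>T. \<exists>s\<in>T. strict_prefix t s \<and> (\<exists>k. k < length s \<and> \<not> k < length t \<and> s ! k = g k))"

definition tight :: "(nat \<Rightarrow> nat) set \<Rightarrow> bool" where
  "tight P \<longleftrightarrow>
     (\<forall>F. countable F \<and> F \<subseteq> positive_trees P \<longrightarrow> (\<exists>g\<in>P. \<forall>T\<in>F. densely_diagonalizes g T))"

section \<open>The forcing language and the forcing relation\<close>

text \<open>Formulas of the language of set theory with constants from \<open>'c\<close>. A quantifier binds
  its variable by a function on constants; the formulas written below are first order and use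
  the function argument only as a constant.\<close>

datatype 'c fm =
    Mem 'c 'c (infix "\<^bold>\<in>" 60)
  | Eq 'c 'c (infix "\<^bold>=" 60)
  | Neg "'c fm" ("\<^bold>\<not> _" [55] 55)
  | And "'c fm" "'c fm" (infixr "\<^bold>\<and>" 50)
  | Forall "'c \<Rightarrow> 'c fm" (binder "\<^bold>\<forall>" 40)

definition Or :: "'c fm \<Rightarrow> 'c fm \<Rightarrow> 'c fm" (infixr "\<^bold>\<or>" 48) where
  "(\<phi> \<^bold>\<or> \<psi>) = (\<^bold>\<not> (\<^bold>\<not> \<phi> \<^bold>\<and> \<^bold>\<not> \<psi>))"

definition Imp :: "'c fm \<Rightarrow> 'c fm \<Rightarrow> 'c fm" (infixr "\<^bold>\<longrightarrow>" 45) where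
  "(\<phi> \<^bold>\<longrightarrow> \<psi>) = (\<^bold>\<not> (\<phi> \<^bold>\<and> \<^bold>\<not> \<psi>))"

definition Iff :: "'c fm \<Rightarrow> 'c fm \<Rightarrow> 'c fm" (infix "\<^bold>\<longleftrightarrow>" 43) where
  "(\<phi> \<^bold>\<longleftrightarrow> \<psi>) = ((\<phi> \<^bold>\<longrightarrow> \<psi>) \<^bold>\<and> (\<psi> \<^bold>\<longrightarrow> \<phi>))"

definition Exists :: "('c \<Rightarrow> 'c fm) \<Rightarrow> 'c fm" (binder "\<^bold>\<exists>" 40) where
  "(\<^bold>\<exists>x. \<phi> x) = (\<^bold>\<not> (\<^bold>\<forall>x. \<^bold>\<not> \<phi> x))"

text \<open>\<open>Name I \<sigma> c\<close> is the name \<open>{(\<sigma> i, c i) | i \<in> I}\<close>. Thus \<open>('i, 'p) name\<close> consists of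
  the names over the conditions \<open>'p\<close> that hereditarily have at most \<open>|'i|\<close> elements. A name
  has many representations; they have the same \<open>elts\<close>, and forcing depends only on these.\<close>

datatype ('i, 'p) name = EmptyName | Name "'i set" "'i \<Rightarrow> ('i, 'p) name" "'i \<Rightarrow> 'p"

fun elts :: "('i, 'p) name \<Rightarrow> (('i, 'p) name \<times> 'p) set" where
  "elts EmptyName = {}"
| "elts (Name I \<sigma> c) = {(\<sigma> i, c i) | i. i \<in> I}"

text \<open>A notion of forcing is given by its reflexive order relation \<open>Q\<close>: the conditions are
  the elements of \<open>Field Q\<close>, and \<open>(q, p) \<in> Q\<close> means that \<open>q\<close> is stronger than \<open>p\<close>.\<close>

definition dense_below :: "'p rel \<Rightarrow> 'p \<Rightarrow> 'p set \<Rightarrow> bool" where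
  "dense_below Q p D \<longleftrightarrow> (\<forall>q. (q, p) \<in> Q \<longrightarrow> (\<exists>r\<in>D. (r, q) \<in> Q))"

text \<open>The recursive clause: \<open>p\<close> forces \<open>x = y\<close> iff every \<open>q \<le> p, c\<close> with
  \<open>(\<sigma>, c) \<in> x\<close> forces \<open>\<sigma> \<in> y\<close>, and every \<open>q \<le> p, d\<close> with \<open>(\<tau>, d) \<in> y\<close> forces
  \<open>\<tau> \<in> x\<close>; here the forcing of membership is unfolded to forced equality of elements. See
  \<open>forces_eq_iff\<close> below.\<close>

primrec forces_eq :: "'p rel \<Rightarrow> ('i, 'p) name \<Rightarrow> ('i, 'p) name \<Rightarrow> 'p \<Rightarrow> bool" where
  "forces_eq Q EmptyName = (\<lambda>y p.
     \<forall>(\<tau>, d)\<in>elts y. \<forall>q. (q, p) \<in> Q \<and> (q, d) \<in> Q \<longrightarrow> dense_below Q q {})"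
| "forces_eq Q (Name I \<sigma> c) = (\<lambda>y p.
     (\<forall>i\<in>I. \<forall>q. (q, p) \<in> Q \<and> (q, c i) \<in> Q \<longrightarrow>
        dense_below Q q {r. \<exists>(\<tau>, d)\<in>elts y. (r, d) \<in> Q \<and> forces_eq Q (\<sigma> i) \<tau> r}) \<and>
     (\<forall>(\<tau>, d)\<in>elts y. \<forall>q. (q, p) \<in> Q \<and> (q, d) \<in> Q \<longrightarrow>
        dense_below Q q {r. \<exists>i\<in>I. (r, c i) \<in> Q \<and> forces_eq Q (\<sigma> i) \<tau> r}))"

definition forces_mem :: "'p rel \<Rightarrow> ('i, 'p) name \<Rightarrow> ('i, 'p) name \<Rightarrow> 'p \<Rightarrow> bool" where
  "forces_mem Q x y p \<longleftrightarrow>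
     dense_below Q p {r. \<exists>(\<tau>, d)\<in>elts y. (r, d) \<in> Q \<and> forces_eq Q x \<tau> r}"

primrec forces :: "'p rel \<Rightarrow> 'p \<Rightarrow> ('i, 'p) name fm \<Rightarrow> bool" where
  "forces Q p (x \<^bold>\<in> y) \<longleftrightarrow> forces_mem Q x y p"
| "forces Q p (x \<^bold>= y) \<longleftrightarrow> forces_eq Q x y p"
| "forces Q p (\<^bold>\<not> \<phi>) \<longleftrightarrow> (\<forall>q. (q, p) \<in> Q \<longrightarrow> \<not> forces Q q \<phi>)"
| "forces Q p (\<phi> \<^bold>\<and> \<psi>) \<longleftrightarrow> forces Q p \<phi> \<and> forces Q p \<psi>"
| "forces Q p (Forall \<phi>) \<longleftrightarrow> (\<forall>x. forces Q p (\<phi> x))"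

definition forced :: "'p rel \<Rightarrow> ('i, 'p) name fm \<Rightarrow> bool" where
  "forced Q \<phi> \<longleftrightarrow> (\<forall>p\<in>Field Q. forces Q p \<phi>)"

lemma Ball_elts_Name:
  "(\<forall>(\<tau>, d)\<in>elts (Name I \<sigma> c). R \<tau> d) \<longleftrightarrow> (\<forall>i\<in>I. R (\<sigma> i) (c i))"
  by auto

lemma forces_eq_sym: "forces_eq Q x y p \<longleftrightarrow> forces_eq Q y x p"
proof (induction x arbitrary: y p)
  case EmptyName
  show ?case by (cases y) auto
next
  case (Name I \<sigma> c)
  have IH: "forces_eq Q (\<sigma> i) z r \<longleftrightarrow> forces_eq Q z (\<sigma> i) r" for i z r
    using Name by blast
  show ?case
  proof (cases y)
    case EmptyName
    then show ?thesis by auto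
  next
    case y: (Name J \<tau> d)
    have *: "{r. \<exists>(\<tau>', d')\<in>elts (Name J \<tau> d). (r, d') \<in> Q \<and> forces_eq Q (\<sigma> i) \<tau>' r} =
             {r. \<exists>j\<in>J. (r, d j) \<in> Q \<and> forces_eq Q (\<tau> j) (\<sigma> i) r}" for i
      by (auto simp: IH)
    have **: "{r. \<exists>(\<tau>', d')\<in>elts (Name I \<sigma> c). (r, d') \<in> Q \<and> forces_eq Q (\<tau> j) \<tau>' r} =
             {r. \<exists>i\<in>I. (r, c i) \<in> Q \<and> forces_eq Q (\<sigma> i) (\<tau> j) r}" for j
      by (auto simp: IH)
    show ?thesis unfolding y forces_eq.simps * ** Ball_elts_Name by blast
  qed
qed

lemma forces_eq_iff:
  "forces_eq Q x y p \<longleftrightarrow>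
     (\<forall>(\<sigma>, c)\<in>elts x. \<forall>q. (q, p) \<in> Q \<and> (q, c) \<in> Q \<longrightarrow> forces_mem Q \<sigma> y q) \<and>
     (\<forall>(\<tau>, d)\<in>elts y. \<forall>q. (q, p) \<in> Q \<and> (q, d) \<in> Q \<longrightarrow> forces_mem Q \<tau> x q)"
proof (cases x)
  case EmptyName
  then show ?thesis by (auto simp: forces_mem_def)
next
  case (Name I \<sigma> c)
  have *: "{r. \<exists>(\<tau>', d')\<in>elts (Name I \<sigma> c). (r, d') \<in> Q \<and> forces_eq Q \<tau> \<tau>' r} =
           {r. \<exists>i\<in>I. (r, c i) \<in> Q \<and> forces_eq Q (\<sigma> i) \<tau> r}" for \<tau>
    by (auto simp: forces_eq_sym[of Q \<tau>])
  show ?thesis unfolding Name forces_eq.simps forces_mem_def * Ball_elts_Name by blast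
qed

section \<open>Canonical names\<close>

definition name_of :: "(('i, 'p) name \<times> 'p) set \<Rightarrow> ('i, 'p) name" where
  "name_of S = (SOME x. elts x = S)"

lemma elts_name_of:
  fixes S :: "(('i, 'p) name \<times> 'p) set" and e :: "('i, 'p) name \<times> 'p \<Rightarrow> 'i"
  assumes "inj_on e S"
  shows "elts (name_of S) = S"
  unfolding name_of_def
proof (rule someI)
  have "{(fst (inv_into S e i), snd (inv_into S e i)) | i. i \<in> e ` S} = inv_into S e ` e ` S"
    by auto
  then show "elts (Name (e ` S) (fst \<circ> inv_into S e) (snd \<circ> inv_into S e)) = S"
    using assms by (simp add: image_inv_into_cancel inv_into_image_cancel)
qed

text \<open>In the following \<open>one\<close> is the weakest condition.\<close>

definition check_set :: "'p \<Rightarrow> ('i, 'p) name set \<Rightarrow> ('i, 'p) name" where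
  "check_set one A = name_of ((\<lambda>x. (x, one)) ` A)"

primrec check_nat :: "'p \<Rightarrow> nat \<Rightarrow> ('i, 'p) name" where
  "check_nat one 0 = check_set one {}"
| "check_nat one (Suc n) =
     name_of (insert (check_nat one n, one) (elts (check_nat one n)))"

definition check_pair :: "'p \<Rightarrow> nat \<Rightarrow> nat \<Rightarrow> ('i, 'p) name" where
  "check_pair one m n =
     check_set one {check_set one {check_nat one m},
                    check_set one {check_nat one m, check_nat one n}}"

definition check_fun :: "'p \<Rightarrow> (nat \<Rightarrow> nat) \<Rightarrow> ('i, 'p) name" where
  "check_fun one f = check_set one (range (\<lambda>n. check_pair one n (f n)))"

definition check_family :: "'p \<Rightarrow> (nat \<Rightarrow> nat) set \<Rightarrow> ('i, 'p) name" where
  "check_family one P = check_set one (check_fun one ` P)"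

section \<open>Tightness as a formula of set theory\<close>

definition fm_subset :: "'c \<Rightarrow> 'c \<Rightarrow> 'c fm" where
  "fm_subset x y = (\<^bold>\<forall>z. z \<^bold>\<in> x \<^bold>\<longrightarrow> z \<^bold>\<in> y)"

definition fm_empty :: "'c \<Rightarrow> 'c fm" where
  "fm_empty x = (\<^bold>\<forall>z. \<^bold>\<not> (z \<^bold>\<in> x))"

text \<open>\<open>y = x \<union> {x}\<close>\<close>
definition fm_succ :: "'c \<Rightarrow> 'c \<Rightarrow> 'c fm" where
  "fm_succ x y = (\<^bold>\<forall>z. z \<^bold>\<in> y \<^bold>\<longleftrightarrow> (z \<^bold>\<in> x \<^bold>\<or> z \<^bold>= x))"

definition fm_inductive :: "'c \<Rightarrow> 'c fm" where
  "fm_inductive w =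
     ((\<^bold>\<exists>x. fm_empty x \<^bold>\<and> x \<^bold>\<in> w) \<^bold>\<and>
      (\<^bold>\<forall>x. x \<^bold>\<in> w \<^bold>\<longrightarrow> (\<^bold>\<exists>y. fm_succ x y \<^bold>\<and> y \<^bold>\<in> w)))"

definition fm_omega :: "'c \<Rightarrow> 'c fm" where
  "fm_omega w = (fm_inductive w \<^bold>\<and> (\<^bold>\<forall>v. fm_inductive v \<^bold>\<longrightarrow> fm_subset w v))"

text \<open>\<open>z = {x, y}\<close>, \<open>z = (x, y)\<close> (Kuratowski) and \<open>(x, y) \<in> f\<close>\<close>

definition fm_upair :: "'c \<Rightarrow> 'c \<Rightarrow> 'c \<Rightarrow> 'c fm" where
  "fm_upair z x y = (\<^bold>\<forall>u. u \<^bold>\<in> z \<^bold>\<longleftrightarrow> (u \<^bold>= x \<^bold>\<or> u \<^bold>= y))"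

definition fm_pair :: "'c \<Rightarrow> 'c \<Rightarrow> 'c \<Rightarrow> 'c fm" where
  "fm_pair z x y = (\<^bold>\<exists>a. \<^bold>\<exists>b. fm_upair a x x \<^bold>\<and> fm_upair b x y \<^bold>\<and> fm_upair z a b)"

definition fm_pair_in :: "'c \<Rightarrow> 'c \<Rightarrow> 'c \<Rightarrow> 'c fm" where
  "fm_pair_in x y f = (\<^bold>\<exists>z. fm_pair z x y \<^bold>\<and> z \<^bold>\<in> f)"

definition fm_function :: "'c \<Rightarrow> 'c \<Rightarrow> 'c \<Rightarrow> 'c fm" where
  "fm_function f A B =
     ((\<^bold>\<forall>z. z \<^bold>\<in> f \<^bold>\<longrightarrow> (\<^bold>\<exists>x. \<^bold>\<exists>y. x \<^bold>\<in> A \<^bold>\<and> y \<^bold>\<in> B \<^bold>\<and> fm_pair z x y)) \<^bold>\<and>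
      (\<^bold>\<forall>x. x \<^bold>\<in> A \<^bold>\<longrightarrow> (\<^bold>\<exists>y. fm_pair_in x y f)) \<^bold>\<and>
      (\<^bold>\<forall>x. \<^bold>\<forall>y. \<^bold>\<forall>y'. fm_pair_in x y f \<^bold>\<and> fm_pair_in x y' f \<^bold>\<longrightarrow> y \<^bold>= y'))"

definition fm_injective :: "'c \<Rightarrow> 'c fm" where
  "fm_injective f = (\<^bold>\<forall>x. \<^bold>\<forall>x'. \<^bold>\<forall>y. fm_pair_in x y f \<^bold>\<and> fm_pair_in x' y f \<^bold>\<longrightarrow> x \<^bold>= x')"

definition fm_onto :: "'c \<Rightarrow> 'c \<Rightarrow> 'c fm" where
  "fm_onto f B = (\<^bold>\<forall>y. y \<^bold>\<in> B \<^bold>\<longrightarrow> (\<^bold>\<exists>x. fm_pair_in x y f))"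

text \<open>From here on the parameter \<open>w\<close> stands for \<open>\<omega>\<close>.\<close>

definition fm_finite :: "'c \<Rightarrow> 'c \<Rightarrow> 'c fm" where
  "fm_finite w A =
     (\<^bold>\<exists>n. \<^bold>\<exists>f. n \<^bold>\<in> w \<^bold>\<and> fm_function f n A \<^bold>\<and> fm_injective f \<^bold>\<and> fm_onto f A)"

definition fm_countable :: "'c \<Rightarrow> 'c \<Rightarrow> 'c fm" where
  "fm_countable w A = (\<^bold>\<exists>f. fm_function f A w \<^bold>\<and> fm_injective f)"

definition fm_seq :: "'c \<Rightarrow> 'c \<Rightarrow> 'c fm" where
  "fm_seq w t = (\<^bold>\<exists>n. n \<^bold>\<in> w \<^bold>\<and> fm_function t n w)"

text \<open>Between finite sequences, end extension is inclusion of graphs.\<close>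

definition fm_strict_ext :: "'c \<Rightarrow> 'c \<Rightarrow> 'c fm" where
  "fm_strict_ext t s = (fm_subset t s \<^bold>\<and> \<^bold>\<not> (t \<^bold>= s))"

definition fm_tree :: "'c \<Rightarrow> 'c \<Rightarrow> 'c fm" where
  "fm_tree w T =
     ((\<^bold>\<forall>t. t \<^bold>\<in> T \<^bold>\<longrightarrow> fm_seq w t) \<^bold>\<and>
      (\<^bold>\<forall>t. \<^bold>\<forall>s. t \<^bold>\<in> T \<^bold>\<and> fm_seq w s \<^bold>\<and> fm_subset s t \<^bold>\<longrightarrow> s \<^bold>\<in> T) \<^bold>\<and>
      (\<^bold>\<forall>t. t \<^bold>\<in> T \<^bold>\<longrightarrow> (\<^bold>\<exists>s. s \<^bold>\<in> T \<^bold>\<and> fm_strict_ext t s)))"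

definition fm_injective_tree :: "'c \<Rightarrow> 'c \<Rightarrow> 'c fm" where
  "fm_injective_tree w T = (fm_tree w T \<^bold>\<and> (\<^bold>\<forall>t. t \<^bold>\<in> T \<^bold>\<longrightarrow> fm_injective t))"

text \<open>\<open>z \<in> \<Union>T\<^sub>t\<close>\<close>
definition fm_in_Union_subtree :: "'c \<Rightarrow> 'c \<Rightarrow> 'c \<Rightarrow> 'c fm" where
  "fm_in_Union_subtree z T t =
     (\<^bold>\<exists>s. s \<^bold>\<in> T \<^bold>\<and> (fm_subset s t \<^bold>\<or> fm_subset t s) \<^bold>\<and> z \<^bold>\<in> s)"

text \<open>\<open>z \<in> \<Union>X\<close>\<close>
definition fm_in_Union :: "'c \<Rightarrow> 'c \<Rightarrow> 'c fm" where
  "fm_in_Union z X = (\<^bold>\<exists>h. h \<^bold>\<in> X \<^bold>\<and> z \<^bold>\<in> h)"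

text \<open>\<open>D\<close> is the set \<open>\<Union>T\<^sub>t - \<Union>X\<close>.\<close>

definition fm_positive_tree :: "'c \<Rightarrow> 'c \<Rightarrow> 'c \<Rightarrow> 'c fm" where
  "fm_positive_tree w P T =
     (fm_injective_tree w T \<^bold>\<and>
      \<^bold>\<not> (\<^bold>\<exists>t. \<^bold>\<exists>X. \<^bold>\<exists>D. t \<^bold>\<in> T \<^bold>\<and> fm_finite w X \<^bold>\<and> fm_subset X P \<^bold>\<and>
          (\<^bold>\<forall>z. z \<^bold>\<in> D \<^bold>\<longleftrightarrow> (fm_in_Union_subtree z T t \<^bold>\<and> \<^bold>\<not> fm_in_Union z X)) \<^bold>\<and>
          fm_finite w D))"

definition fm_densely_diagonalizes :: "'c \<Rightarrow> 'c \<Rightarrow> 'c fm" where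
  "fm_densely_diagonalizes g T =
     (\<^bold>\<forall>t. t \<^bold>\<in> T \<^bold>\<longrightarrow>
        (\<^bold>\<exists>s. s \<^bold>\<in> T \<^bold>\<and> fm_strict_ext t s \<^bold>\<and>
          (\<^bold>\<exists>k. \<^bold>\<exists>m. fm_pair_in k m s \<^bold>\<and> \<^bold>\<not> (\<^bold>\<exists>l. fm_pair_in k l t) \<^bold>\<and> fm_pair_in k m g)))"

definition fm_tight :: "'c \<Rightarrow> 'c fm" where
  "fm_tight P =
     (\<^bold>\<exists>w. fm_omega w \<^bold>\<and>
        (\<^bold>\<forall>F. fm_countable w F \<^bold>\<and> (\<^bold>\<forall>T. T \<^bold>\<in> F \<^bold>\<longrightarrow> fm_positive_tree w P T) \<^bold>\<longrightarrow>
           (\<^bold>\<exists>g. g \<^bold>\<in> P \<^bold>\<and> (\<^bold>\<forall>T. T \<^bold>\<in> F \<^bold>\<longrightarrow> fm_densely_diagonalizes g T))))"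

section \<open>Adding Cohen reals\<close>

definition cohen_condition :: "'k rel \<Rightarrow> ('k \<times> nat \<rightharpoonup> bool) \<Rightarrow> bool" where
  "cohen_condition \<kappa> p \<longleftrightarrow> finite (dom p) \<and> dom p \<subseteq> Field \<kappa> \<times> UNIV"

text \<open>\<open>Add(\<omega>, \<kappa>)\<close>: finite partial functions from \<open>\<kappa> \<times> \<omega>\<close> to \<open>2\<close>, ordered by reverse
  inclusion. The cardinal is a cardinal order \<open>\<kappa>\<close>, so that \<open>Field \<kappa>\<close> is its set of elements.\<close>

definition Add_omega :: "'k rel \<Rightarrow> ('k \<times> nat \<rightharpoonup> bool) rel" where
  "Add_omega \<kappa> = {(q, p). cohen_condition \<kappa> q \<and> cohen_condition \<kappa> p \<and> p \<subseteq>\<^sub>m q}"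

end

theory Submission
  imports Defs
begin

text \<open>
  Cohen forcing is ccc, so below a condition that forces \<open>F\<close> to be a countable family of positive
  trees, \<open>F\<close> is forced to be covered by countably many pairs \<open>(r, T)\<close> such that \<open>r\<close> forces \<open>T\<close> to be a
  positive tree. Given such pairs, let \<open>C\<close> be a countable set of conditions, and for \<open>c \<in> C\<close> let
  \<open>T\<^sub>c\<close> be the tree of all \<open>s\<close> that some common extension of \<open>r\<close> and \<open>c\<close> forces into \<open>T\<close>. This is
  a positive tree of the ground model, so by tightness one \<open>g \<in> P\<close> densely diagonalizes all these
  trees. If \<open>C\<close> consists of the conditions supported on a countable set that carries, for each pair
  \<open>(r, T)\<close> and each sequence \<open>s\<close>, a maximal antichain of conditions below \<open>r\<close> forcing \<open>s \<in> T\<close>, then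
  each condition \<open>q\<close> below \<open>r\<close> can force into \<open>T\<close> every extension found in \<open>T\<^sub>c\<close>, where \<open>c\<close> is the
  restriction of \<open>q\<close>. Hence \<open>r\<close> forces \<open>g\<close> to densely diagonalize \<open>T\<close>.
\<close>

text \<open>Tightness handles countably many trees, whereas \<open>Add_omega \<kappa>\<close> has
  uncountably many conditions once \<kappa> is uncountable. One tree for each condition, which would
  do for a single Cohen real, is then too many; this is why conditions are first reflected to a
  countable set of coordinates. The tree \<open>T_c\<close> is positive although its nodes need not
  all lie in \<open>T\<close> in any one extension. Each node is put into \<open>T\<close> by a
  condition of its own, and positivity at that node is checked below this condition: if only
  finitely many pairs could ever enter \<Union>\<open>T_t\<close> - \<Union>\<open>X\<close>, a
  stronger condition would decide all of them, and the difference would be forced to be finite. The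
  cover of \<open>F\<close> is read off from an injection of \<open>F\<close> into \<omega>. For
  each \<open>n\<close> there is a countable predense set of conditions, each with a name that it
  forces to have index \<open>n\<close>. A condition stays paired with its name, since the name is
  known to be positive only below it.\<close>

declare forces.simps [simp del] check_nat.simps [simp del]

section \<open>Graphs of finite sequences and of functions\<close>

lemma graph_seq_mem: "(k, m) \<in> graph_seq s \<longleftrightarrow> k < length s \<and> m = s ! k"
  unfolding graph_seq_def by auto

lemma graph_fun_mem: "(k, m) \<in> graph_fun f \<longleftrightarrow> m = f k"
  unfolding graph_fun_def by auto

text \<open>The domains are initial segments of \<omega>, so inclusion of graphs is already end
  extension. This lets \<open>fm_subset\<close> stand for \<open>prefix\<close> in the formulas
  about trees.\<close>

lemma graph_seq_subset: "graph_seq s \<subseteq> graph_seq t \<longleftrightarrow> prefix s t"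
proof
  assume *: "graph_seq s \<subseteq> graph_seq t"
  then have **: "k < length t \<and> s ! k = t ! k" if "k < length s" for k
    using that graph_seq_mem by (metis subsetD)
  \<comment> \<open>Otherwise \<open>length t\<close> would be a position of \<open>s\<close>, and
    \<open>**\<close> would put \<open>length t\<close> below itself.\<close>
  then have "length s \<le> length t" by (meson leI less_irrefl)
  then have "s = take (length s) t" using ** by (intro nth_equalityI) auto
  then show "prefix s t" by (metis take_is_prefix)
next
  assume "prefix s t"
  then show "graph_seq s \<subseteq> graph_seq t"
    by (auto simp: graph_seq_mem prefix_def nth_append)
qed

lemma graph_seq_eq: "graph_seq s = graph_seq t \<longleftrightarrow> s = t"
  by (metis graph_seq_subset prefix_order.antisym subset_refl)

subsection \<open>Forcing logic\<close>

text \<open>The map \<open>enc\<close> makes the index type \<open>'i\<close> at least as large as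
  the continuum, so that one name can hold all of \<open>P\<close>.\<close>

locale forcing_notion =
  fixes Q :: "'p rel" and one :: 'p and enc :: "(nat \<Rightarrow> nat) \<Rightarrow> 'i"
  assumes refl_Q: "p \<in> Field Q \<Longrightarrow> (p, p) \<in> Q"
    and trans_Q: "(r, q) \<in> Q \<Longrightarrow> (q, p) \<in> Q \<Longrightarrow> (r, p) \<in> Q"
    and one_greatest: "p \<in> Field Q \<Longrightarrow> (p, one) \<in> Q"
    and inj_enc: "inj enc"
begin

abbreviation leq :: "'p \<Rightarrow> 'p \<Rightarrow> bool" (infix "\<preceq>" 50) where
  "q \<preceq> p \<equiv> (q, p) \<in> Q"

abbreviation frc :: "'p \<Rightarrow> ('i, 'p) name fm \<Rightarrow> bool" (infix "\<tturnstile>" 38) where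
  "p \<tturnstile> \<phi> \<equiv> forces Q p \<phi>"

text \<open>A premise \<open>p \<preceq> p\<close> below says that \<open>p\<close> is a condition.
  Anything outside \<open>Field Q\<close> has nothing below it and forces every formula, so the
  premise appears where a forced statement is turned into a fact.\<close>

lemma leq_refl: "q \<preceq> p \<Longrightarrow> q \<preceq> q" "q \<preceq> p \<Longrightarrow> p \<preceq> p"
  by (auto intro: refl_Q FieldI1 FieldI2)

lemma leq_one: "q \<preceq> p \<Longrightarrow> q \<preceq> one"
  by (auto intro: one_greatest FieldI1)

lemma forced_mem_iff:
  "p \<tturnstile> x \<^bold>\<in> y \<longleftrightarrow> (\<forall>q. q \<preceq> p \<longrightarrow> (\<exists>r \<tau> d. r \<preceq> q \<and> (\<tau>, d) \<in> elts y \<and> r \<preceq> d \<and> (r \<tturnstile> x \<^bold>= \<tau>)))"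
  unfolding forces.simps forces_mem_def dense_below_def by fast

lemma forced_eq_iff:
  "p \<tturnstile> x \<^bold>= y \<longleftrightarrow>
    (\<forall>\<sigma> c q. (\<sigma>, c) \<in> elts x \<longrightarrow> q \<preceq> p \<longrightarrow> q \<preceq> c \<longrightarrow> (q \<tturnstile> \<sigma> \<^bold>\<in> y)) \<and>
    (\<forall>\<tau> d q. (\<tau>, d) \<in> elts y \<longrightarrow> q \<preceq> p \<longrightarrow> q \<preceq> d \<longrightarrow> (q \<tturnstile> \<tau> \<^bold>\<in> x))"
  unfolding forces.simps by (subst forces_eq_iff) fast

section \<open>Forced equality is a congruence\<close>

lemma eq_mono: "p \<tturnstile> x \<^bold>= y \<Longrightarrow> q \<preceq> p \<Longrightarrow> q \<tturnstile> x \<^bold>= y"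
  unfolding forced_eq_iff by (blast intro: trans_Q)

lemma eqD1: "p \<tturnstile> x \<^bold>= y \<Longrightarrow> (\<sigma>, c) \<in> elts x \<Longrightarrow> q \<preceq> p \<Longrightarrow> q \<preceq> c \<Longrightarrow> q \<tturnstile> \<sigma> \<^bold>\<in> y"
  and eqD2: "p \<tturnstile> x \<^bold>= y \<Longrightarrow> (\<tau>, d) \<in> elts y \<Longrightarrow> q \<preceq> p \<Longrightarrow> q \<preceq> d \<Longrightarrow> q \<tturnstile> \<tau> \<^bold>\<in> x"
  unfolding forced_eq_iff by blast+

lemma mem_mono: "p \<tturnstile> x \<^bold>\<in> y \<Longrightarrow> q \<preceq> p \<Longrightarrow> q \<tturnstile> x \<^bold>\<in> y"
  unfolding forced_mem_iff by (blast intro: trans_Q)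

lemma mem_dense:
  assumes "\<And>q. q \<preceq> p \<Longrightarrow> \<exists>r. r \<preceq> q \<and> (r \<tturnstile> x \<^bold>\<in> y)"
  shows "p \<tturnstile> x \<^bold>\<in> y"
  unfolding forced_mem_iff
proof (intro allI impI)
  fix q assume "q \<preceq> p"
  with assms obtain r where "r \<preceq> q" "r \<tturnstile> x \<^bold>\<in> y" by blast
  then show "\<exists>r \<tau> d. r \<preceq> q \<and> (\<tau>, d) \<in> elts y \<and> r \<preceq> d \<and> (r \<tturnstile> x \<^bold>= \<tau>)"
    unfolding forced_mem_iff by (meson leq_refl trans_Q)
qed

lemma eq_dense:
  assumes *: "\<And>q. q \<preceq> p \<Longrightarrow> \<exists>r. r \<preceq> q \<and> (r \<tturnstile> x \<^bold>= y)"
  shows "p \<tturnstile> x \<^bold>= y"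
  unfolding forced_eq_iff
proof (intro conjI allI impI)
  fix \<sigma> c q assume "(\<sigma>, c) \<in> elts x" "q \<preceq> p" "q \<preceq> c"
  then show "q \<tturnstile> \<sigma> \<^bold>\<in> y"
    using * by (intro mem_dense) (metis forced_eq_iff leq_refl(1) trans_Q)
next
  fix \<tau> d q assume "(\<tau>, d) \<in> elts y" "q \<preceq> p" "q \<preceq> d"
  then show "q \<tturnstile> \<tau> \<^bold>\<in> x"
    using * by (intro mem_dense) (metis forced_eq_iff leq_refl(1) trans_Q)
qed

lemma eq_sym: "p \<tturnstile> x \<^bold>= y \<Longrightarrow> p \<tturnstile> y \<^bold>= x"
  unfolding forces.simps by (rule iffD1[OF forces_eq_sym])

lemma elts_mem:
  assumes "\<And>q. q \<preceq> p \<Longrightarrow> q \<tturnstile> x \<^bold>= \<tau>" "(\<tau>, d) \<in> elts y" "p \<preceq> d"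
  shows "p \<tturnstile> x \<^bold>\<in> y"
  unfolding forced_mem_iff using assms by (meson leq_refl(1) trans_Q)

lemma eq_refl: "p \<tturnstile> x \<^bold>= x"
proof (induction x arbitrary: p)
  case EmptyName
  show ?case unfolding forced_eq_iff by simp
next
  case (Name I \<sigma> c)
  have "q \<tturnstile> \<tau> \<^bold>\<in> Name I \<sigma> c" if "(\<tau>, d) \<in> elts (Name I \<sigma> c)" "q \<preceq> d" for q \<tau> d
    using that Name by (intro elts_mem[OF _ that]) auto
  then show ?case unfolding forced_eq_iff by blast
qed

text \<open>Only the first name has to get smaller, so \<open>y\<close> and \<open>z\<close> stay
  arbitrary in the induction. An element of \<open>z\<close> is traced through \<open>y\<close> to
  an element of \<open>x\<close>; by \<open>eq_sym\<close> the resulting chain is read backwards, so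
  that the element of \<open>x\<close> comes first again.\<close>

lemma eq_trans: "p \<tturnstile> x \<^bold>= y \<Longrightarrow> p \<tturnstile> y \<^bold>= z \<Longrightarrow> p \<tturnstile> x \<^bold>= z"
proof (induction x arbitrary: y z p)
  case EmptyName
  show ?case unfolding forced_eq_iff
  proof (intro conjI allI impI)
    fix \<rho> e q assume "(\<rho>, e) \<in> elts z" "q \<preceq> p" "q \<preceq> e"
    then have "q \<tturnstile> \<rho> \<^bold>\<in> y" using eqD2[OF EmptyName(2)] by blast
    then obtain r \<tau> d where r: "r \<preceq> q" "(\<tau>, d) \<in> elts y" "r \<preceq> d"
      unfolding forced_mem_iff using \<open>q \<preceq> p\<close> leq_refl by blast
    then have "r \<tturnstile> \<tau> \<^bold>\<in> EmptyName" using eqD2[OF EmptyName(1) r(2) _ r(3)] \<open>q \<preceq> p\<close> trans_Q by blast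
    then show "q \<tturnstile> \<rho> \<^bold>\<in> EmptyName" using r(1) leq_refl unfolding forced_mem_iff by fastforce
  qed simp
next
  case (Name I \<sigma> c)
  have IH: "r \<tturnstile> v \<^bold>= w" if "(v, d) \<in> elts (Name I \<sigma> c)" "r \<tturnstile> v \<^bold>= u" "r \<tturnstile> u \<^bold>= w" for r v d u w
    using that Name.IH by auto
  show ?case unfolding forced_eq_iff
  proof (intro conjI allI impI)
    fix \<upsilon> e q assume 1: "(\<upsilon>, e) \<in> elts (Name I \<sigma> c)" "q \<preceq> p" "q \<preceq> e"
    then have "q \<tturnstile> \<upsilon> \<^bold>\<in> y" using eqD1[OF Name.prems(1)] by blast
    show "q \<tturnstile> \<upsilon> \<^bold>\<in> z" unfolding forced_mem_iff
    proof (intro allI impI)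
      fix q' assume "q' \<preceq> q"
      then obtain r \<tau> d where r: "r \<preceq> q'" "(\<tau>, d) \<in> elts y" "r \<preceq> d" "r \<tturnstile> \<upsilon> \<^bold>= \<tau>"
        using \<open>q \<tturnstile> \<upsilon> \<^bold>\<in> y\<close> unfolding forced_mem_iff by blast
      then have "r \<tturnstile> \<tau> \<^bold>\<in> z"
        using eqD1[OF Name.prems(2) r(2) _ r(3)] 1 \<open>q' \<preceq> q\<close> trans_Q by blast
      then obtain r' \<rho> d' where r': "r' \<preceq> r" "(\<rho>, d') \<in> elts z" "r' \<preceq> d'" "r' \<tturnstile> \<tau> \<^bold>= \<rho>"
        using r(1) leq_refl unfolding forced_mem_iff by blast
      then have "r' \<tturnstile> \<upsilon> \<^bold>= \<rho>" using IH[OF 1(1)] r(4) eq_mono by blast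
      with r' r show "\<exists>r \<tau> d. r \<preceq> q' \<and> (\<tau>, d) \<in> elts z \<and> r \<preceq> d \<and> (r \<tturnstile> \<upsilon> \<^bold>= \<tau>)"
        using trans_Q by blast
    qed
  next
    fix \<rho> e q assume 1: "(\<rho>, e) \<in> elts z" "q \<preceq> p" "q \<preceq> e"
    then have "q \<tturnstile> \<rho> \<^bold>\<in> y" using eqD2[OF Name.prems(2)] by blast
    show "q \<tturnstile> \<rho> \<^bold>\<in> Name I \<sigma> c" unfolding forced_mem_iff
    proof (intro allI impI)
      fix q' assume "q' \<preceq> q"
      then obtain r \<tau> d where r: "r \<preceq> q'" "(\<tau>, d) \<in> elts y" "r \<preceq> d" "r \<tturnstile> \<rho> \<^bold>= \<tau>"
        using \<open>q \<tturnstile> \<rho> \<^bold>\<in> y\<close> unfolding forced_mem_iff by blast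
      then have "r \<tturnstile> \<tau> \<^bold>\<in> Name I \<sigma> c"
        using eqD2[OF Name.prems(1) r(2) _ r(3)] 1 \<open>q' \<preceq> q\<close> trans_Q by blast
      then obtain r' \<upsilon> d' where r': "r' \<preceq> r" "(\<upsilon>, d') \<in> elts (Name I \<sigma> c)" "r' \<preceq> d'" "r' \<tturnstile> \<tau> \<^bold>= \<upsilon>"
        using r(1) leq_refl unfolding forced_mem_iff by blast
      then have "r' \<tturnstile> \<rho> \<^bold>= \<upsilon>" using IH[OF r'(2)] r(4) eq_mono eq_sym by blast
      with r' r show "\<exists>r \<tau> d. r \<preceq> q' \<and> (\<tau>, d) \<in> elts (Name I \<sigma> c) \<and> r \<preceq> d \<and> (r \<tturnstile> \<rho> \<^bold>= \<tau>)"
        using trans_Q by blast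
    qed
  qed
qed

lemma mem_cong1: "p \<tturnstile> x \<^bold>\<in> y \<Longrightarrow> p \<tturnstile> x \<^bold>= x' \<Longrightarrow> p \<tturnstile> x' \<^bold>\<in> y"
  unfolding forced_mem_iff by (meson eq_mono eq_sym eq_trans trans_Q)

lemma mem_cong2:
  assumes "p \<tturnstile> x \<^bold>\<in> y" "p \<tturnstile> y \<^bold>= y'"
  shows "p \<tturnstile> x \<^bold>\<in> y'"
proof (rule mem_dense)
  fix q assume q: "q \<preceq> p"
  then obtain r \<tau> d where r: "r \<preceq> q" "(\<tau>, d) \<in> elts y" "r \<preceq> d" "r \<tturnstile> x \<^bold>= \<tau>"
    using assms(1) unfolding forced_mem_iff by blast
  then have "r \<tturnstile> \<tau> \<^bold>\<in> y'" using assms(2) q forced_eq_iff trans_Q by blast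
  then show "\<exists>r. r \<preceq> q \<and> (r \<tturnstile> x \<^bold>\<in> y')" using r mem_cong1 eq_sym by blast
qed

lemma eqI:
  assumes "\<And>q z. q \<preceq> p \<Longrightarrow> q \<tturnstile> z \<^bold>\<in> x \<Longrightarrow> q \<tturnstile> z \<^bold>\<in> y"
    and "\<And>q z. q \<preceq> p \<Longrightarrow> q \<tturnstile> z \<^bold>\<in> y \<Longrightarrow> q \<tturnstile> z \<^bold>\<in> x"
  shows "p \<tturnstile> x \<^bold>= y"
  unfolding forced_eq_iff using assms elts_mem[OF eq_refl] by blast

section \<open>Monotonicity, density and derived connectives\<close>

lemma forces_mono: "p \<tturnstile> \<phi> \<Longrightarrow> q \<preceq> p \<Longrightarrow> q \<tturnstile> \<phi>"
proof (induction \<phi> arbitrary: p q)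
  case (Mem x y) then show ?case using mem_mono by blast
next
  case (Eq x y) then show ?case using eq_mono by blast
next
  case (Neg \<phi>) then show ?case by (auto simp: forces.simps intro: trans_Q)
next
  case (And \<phi> \<psi>) then show ?case by (meson forces.simps(4))
next
  case (Forall \<phi>) then show ?case by (meson forces.simps(5) rangeI)
qed

text \<open>The primitive connectives all preserve this property, and disjunction and existence are
  defined from them. The lemma takes the place of a generic filter: a proof may pass to stronger
  conditions at will, and witnesses have to exist only there.\<close>

lemma forces_dense:
  assumes "\<And>q. q \<preceq> p \<Longrightarrow> \<exists>r. r \<preceq> q \<and> (r \<tturnstile> \<phi>)"
  shows "p \<tturnstile> \<phi>"
  using assms
proof (induction \<phi> arbitrary: p)
  case (Mem x y) then show ?case using mem_dense by blast
next
  case (Eq x y) then show ?case using eq_dense by blast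
next
  case (Neg \<phi>)
  show ?case unfolding forces.simps
  proof (intro allI impI notI)
    fix q assume "q \<preceq> p" "q \<tturnstile> \<phi>"
    then obtain r where "r \<preceq> q" "r \<tturnstile> \<^bold>\<not> \<phi>" using Neg.prems by blast
    then show False using \<open>q \<tturnstile> \<phi>\<close> leq_refl(1) forces_mono unfolding forces.simps by blast
  qed
next
  case (And \<phi> \<psi>) then show ?case by (meson forces.simps(4))
next
  case (Forall \<phi>) then show ?case by (meson forces.simps(5) rangeI)
qed

lemma forces_ImpI: "(\<And>q. q \<preceq> p \<Longrightarrow> q \<tturnstile> \<phi> \<Longrightarrow> q \<tturnstile> \<psi>) \<Longrightarrow> p \<tturnstile> \<phi> \<^bold>\<longrightarrow> \<psi>"
  unfolding Imp_def forces.simps using leq_refl(1) by blast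

text \<open>\<open>Imp\<close> is a classical abbreviation and yields \<psi> only at densely many
  conditions below \<open>p\<close>; \<open>forces_dense\<close> brings it back to
  \<open>p\<close>.\<close>

lemma forces_ImpD:
  assumes "p \<tturnstile> \<phi> \<^bold>\<longrightarrow> \<psi>" "p \<tturnstile> \<phi>"
  shows "p \<tturnstile> \<psi>"
proof (rule forces_dense)
  fix q assume "q \<preceq> p"
  moreover from this assms(2) have "q \<tturnstile> \<phi>" using forces_mono by blast
  ultimately show "\<exists>r. r \<preceq> q \<and> (r \<tturnstile> \<psi>)"
    using assms(1) unfolding Imp_def forces.simps by blast
qed

lemma forces_Imp: "(p \<tturnstile> \<phi> \<^bold>\<longrightarrow> \<psi>) \<longleftrightarrow> (\<forall>q. q \<preceq> p \<longrightarrow> (q \<tturnstile> \<phi>) \<longrightarrow> (q \<tturnstile> \<psi>))"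
  using forces_ImpI forces_ImpD[OF forces_mono] by blast

lemma forces_Iff: "(p \<tturnstile> \<phi> \<^bold>\<longleftrightarrow> \<psi>) \<longleftrightarrow> (\<forall>q. q \<preceq> p \<longrightarrow> (q \<tturnstile> \<phi>) = (q \<tturnstile> \<psi>))"
  unfolding Iff_def forces.simps forces_Imp by blast

lemma forces_Ex: "(p \<tturnstile> (\<^bold>\<exists>x. \<phi> x)) \<longleftrightarrow> (\<forall>q. q \<preceq> p \<longrightarrow> (\<exists>r x. r \<preceq> q \<and> (r \<tturnstile> \<phi> x)))"
  unfolding Exists_def forces.simps by blast

lemma forces_Or:
  "(p \<tturnstile> \<phi> \<^bold>\<or> \<psi>) \<longleftrightarrow> (\<forall>q. q \<preceq> p \<longrightarrow> (\<exists>r. r \<preceq> q \<and> ((r \<tturnstile> \<phi>) \<or> (r \<tturnstile> \<psi>))))"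
  unfolding Or_def forces.simps using leq_refl(1) trans_Q forces_mono by blast

lemma forces_ExI: "p \<tturnstile> \<phi> x \<Longrightarrow> p \<tturnstile> (\<^bold>\<exists>x. \<phi> x)"
  unfolding forces_Ex by (meson leq_refl(1) forces_mono)

text \<open>\<open>p\<close> itself may have no witness, but densely many conditions below it do. As
  the conclusion is a forced formula, arguing at those conditions is enough.\<close>

lemma forces_ExE:
  assumes "p \<tturnstile> (\<^bold>\<exists>x. \<phi> x)" "\<And>q x. q \<preceq> p \<Longrightarrow> q \<tturnstile> \<phi> x \<Longrightarrow> q \<tturnstile> \<psi>"
  shows "p \<tturnstile> \<psi>"
  using assms unfolding forces_Ex by (intro forces_dense) (meson trans_Q)

lemma forces_OrE:
  assumes "p \<tturnstile> \<phi> \<^bold>\<or> \<chi>" "\<And>q. q \<preceq> p \<Longrightarrow> q \<tturnstile> \<phi> \<Longrightarrow> q \<tturnstile> \<psi>"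
    "\<And>q. q \<preceq> p \<Longrightarrow> q \<tturnstile> \<chi> \<Longrightarrow> q \<tturnstile> \<psi>"
  shows "p \<tturnstile> \<psi>"
  using assms unfolding forces_Or by (intro forces_dense) (meson trans_Q)

lemma forces_OrI: "(p \<tturnstile> \<phi>) \<or> (p \<tturnstile> \<psi>) \<Longrightarrow> p \<tturnstile> \<phi> \<^bold>\<or> \<psi>"
  unfolding forces_Or by (meson leq_refl(1) forces_mono)

lemma eq_ext: "p \<tturnstile> x \<^bold>= y \<longleftrightarrow> (\<forall>z q. q \<preceq> p \<longrightarrow> (q \<tturnstile> z \<^bold>\<in> x) = (q \<tturnstile> z \<^bold>\<in> y))"
proof (intro iffI allI impI)
  fix z q assume *: "p \<tturnstile> x \<^bold>= y" "q \<preceq> p"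
  show "q \<tturnstile> z \<^bold>\<in> x" if "q \<tturnstile> z \<^bold>\<in> y" using mem_cong2[OF that eq_sym[OF eq_mono[OF *]]] .
  show "q \<tturnstile> z \<^bold>\<in> y" if "q \<tturnstile> z \<^bold>\<in> x" using mem_cong2[OF that eq_mono[OF *]] .
qed (rule eqI; blast)

lemma eq_cong: "p \<tturnstile> x \<^bold>= x' \<Longrightarrow> p \<tturnstile> y \<^bold>= y' \<Longrightarrow> p \<tturnstile> x \<^bold>= y \<longleftrightarrow> p \<tturnstile> x' \<^bold>= y'"
  using eq_sym eq_trans by metis

lemma mem_cong: "p \<tturnstile> x \<^bold>= x' \<Longrightarrow> p \<tturnstile> y \<^bold>= y' \<Longrightarrow> p \<tturnstile> x \<^bold>\<in> y \<longleftrightarrow> p \<tturnstile> x' \<^bold>\<in> y'"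
  using mem_cong1 mem_cong2 eq_sym by metis

subsection \<open>Check names and ordered pairs\<close>

text \<open>A set of pairs is the \<open>elts\<close> of a name only if it injects into the index
  type; for other sets \<open>name_of\<close> is an arbitrary name.\<close>

definition small :: "('i, 'p) name set \<Rightarrow> bool" where
  "small A \<longleftrightarrow> (\<exists>e :: ('i, 'p) name \<Rightarrow> 'i. inj_on e A)"

lemma small_image: "small (h ` (B :: (nat \<Rightarrow> nat) set))"
proof -
  have "inj_on (enc \<circ> inv_into B h) (h ` B)"
    using inj_enc by (auto intro!: comp_inj_on inj_on_inv_into intro: inj_on_subset)
  then show ?thesis unfolding small_def by blast
qed

lemma small_countable:
  assumes "countable A"
  shows "small A"
proof -
  \<comment> \<open>Constant functions code the natural numbers in the domain of
    \<open>enc\<close>.\<close>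
  have "inj (\<lambda>n (_::nat). n :: nat)" by (auto simp: inj_def fun_eq_iff)
  then have "inj_on (enc \<circ> (\<lambda>n _. n) \<circ> to_nat_on A) A"
    using inj_enc assms
    by (intro comp_inj_on inj_on_to_nat_on) (auto intro: inj_on_subset)
  then show ?thesis unfolding small_def by blast
qed

text \<open>Stated through \<open>elts\<close>, so that it covers \<open>check_set\<close> as well
  as the recursively defined \<open>check_nat\<close>, whichever representation
  \<open>name_of\<close> picks.\<close>

definition is_check :: "('i, 'p) name \<Rightarrow> ('i, 'p) name set \<Rightarrow> bool" where
  "is_check y A \<longleftrightarrow> elts y = (\<lambda>x. (x, one)) ` A"

lemma elts_name_of_small:
  assumes "small A"
  shows "elts (name_of ((\<lambda>x. (x, one)) ` A)) = (\<lambda>x. (x, one)) ` A"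
proof -
  obtain e :: "('i, 'p) name \<Rightarrow> 'i" where "inj_on e A" using assms small_def by blast
  then have "inj_on (e \<circ> fst) ((\<lambda>x. (x, one)) ` A)" by (auto simp: inj_on_def)
  then show ?thesis by (rule elts_name_of)
qed

lemma is_check_set: "small A \<Longrightarrow> is_check (check_set one A) A"
  unfolding check_set_def is_check_def by (rule elts_name_of_small)

lemma is_check_countable: "countable A \<Longrightarrow> is_check (check_set one A) A"
  by (simp add: small_countable is_check_set)

lemma is_check_nat: "is_check (check_nat one n) (check_nat one ` {..<n})"
proof (induction n)
  case 0
  then show ?case using is_check_countable[of "{}"] by (simp add: check_nat.simps)
next
  case (Suc n)
  have "insert (check_nat one n, one) (elts (check_nat one n :: ('i, 'p) name)) =
      (\<lambda>x. (x, one)) ` check_nat one ` {..<Suc n}"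
    using Suc unfolding is_check_def by (simp only: lessThan_Suc image_insert)
  then show ?case unfolding is_check_def check_nat.simps
    by (simp only: elts_name_of_small[OF small_countable[OF countable_finite]] finite_imageI finite_lessThan)
qed

lemma is_check_mem:
  assumes "is_check y A"
  shows "p \<tturnstile> x \<^bold>\<in> y \<longleftrightarrow> (\<forall>q. q \<preceq> p \<longrightarrow> (\<exists>r a. r \<preceq> q \<and> a \<in> A \<and> (r \<tturnstile> x \<^bold>= a)))"
proof -
  have "(\<tau>, d) \<in> elts y \<longleftrightarrow> \<tau> \<in> A \<and> d = one" for \<tau> d
    using assms unfolding is_check_def by auto
  then show ?thesis unfolding forced_mem_iff using leq_one by metis
qed

lemma is_check_memI: "is_check y A \<Longrightarrow> a \<in> A \<Longrightarrow> p \<tturnstile> a \<^bold>\<in> y"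
  unfolding is_check_mem using eq_refl leq_refl by blast

lemma is_check_memE:
  assumes "is_check y A" "p \<tturnstile> x \<^bold>\<in> y"
    and "\<And>q a. q \<preceq> p \<Longrightarrow> a \<in> A \<Longrightarrow> q \<tturnstile> x \<^bold>= a \<Longrightarrow> q \<tturnstile> \<psi>"
  shows "p \<tturnstile> \<psi>"
  using assms(2,3) unfolding is_check_mem[OF assms(1)] by (intro forces_dense) (meson trans_Q)

lemma is_check_obtain:
  assumes "is_check y A" "p \<tturnstile> x \<^bold>\<in> y" "p \<preceq> p"
  obtains q a where "q \<preceq> p" "a \<in> A" "q \<tturnstile> x \<^bold>= a"
  using assms unfolding is_check_mem[OF assms(1)] by blast

abbreviation upair :: "('i, 'p) name \<Rightarrow> ('i, 'p) name \<Rightarrow> ('i, 'p) name" where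
  "upair x y \<equiv> check_set one {x, y}"

lemma mem_upair: "p \<tturnstile> z \<^bold>\<in> upair x y \<longleftrightarrow> p \<tturnstile> z \<^bold>= x \<^bold>\<or> z \<^bold>= y"
  unfolding forces_Or is_check_mem[OF is_check_countable[of "{x, y}", simplified]] by blast

lemma mem_singleton: "p \<tturnstile> z \<^bold>\<in> check_set one {x} \<longleftrightarrow> p \<tturnstile> z \<^bold>= x"
  using mem_upair[of p z x x] forces_OrE forces_OrI by (metis insert_absorb2)

lemma fm_upair_iff: "p \<tturnstile> fm_upair z x y \<longleftrightarrow> p \<tturnstile> z \<^bold>= upair x y"
  unfolding fm_upair_def forces.simps(5) forces_Iff eq_ext mem_upair by blast

lemma forces_Or_cong:
  assumes "\<And>q. q \<preceq> p \<Longrightarrow> (q \<tturnstile> \<phi>) = (q \<tturnstile> \<phi>')" "\<And>q. q \<preceq> p \<Longrightarrow> (q \<tturnstile> \<psi>) = (q \<tturnstile> \<psi>')"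
  shows "p \<tturnstile> \<phi> \<^bold>\<or> \<psi> \<longleftrightarrow> p \<tturnstile> \<phi>' \<^bold>\<or> \<psi>'"
  unfolding forces_Or using assms trans_Q by meson

lemma upair_cong: "p \<tturnstile> x \<^bold>= x' \<Longrightarrow> p \<tturnstile> y \<^bold>= y' \<Longrightarrow> p \<tturnstile> upair x y \<^bold>= upair x' y'"
  unfolding eq_ext[of _ "upair _ _"] mem_upair
  by (intro allI impI forces_Or_cong eq_cong eq_refl; metis eq_mono trans_Q)

text \<open>Kuratowski pairs of arbitrary names and not only of numerals, because an injection of
  \<open>F\<close> into \<omega> pairs a name of a tree with a numeral.\<close>

definition opair :: "('i, 'p) name \<Rightarrow> ('i, 'p) name \<Rightarrow> ('i, 'p) name" where
  "opair x y = upair (upair x x) (upair x y)"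

lemma check_pair_eq: "check_pair one m n = opair (check_nat one m) (check_nat one n)"
  unfolding check_pair_def opair_def by simp

lemma opair_cong: "p \<tturnstile> x \<^bold>= x' \<Longrightarrow> p \<tturnstile> y \<^bold>= y' \<Longrightarrow> p \<tturnstile> opair x y \<^bold>= opair x' y'"
  unfolding opair_def by (intro upair_cong)

lemma fm_pair_iff: "p \<tturnstile> fm_pair z x y \<longleftrightarrow> p \<tturnstile> z \<^bold>= opair x y"
proof
  assume "p \<tturnstile> fm_pair z x y"
  then show "p \<tturnstile> z \<^bold>= opair x y"
    unfolding fm_pair_def
  proof (elim forces_ExE, unfold forces.simps(4) fm_upair_iff, elim conjE)
    fix q a r b assume "r \<preceq> q" "r \<tturnstile> a \<^bold>= upair x x" "r \<tturnstile> b \<^bold>= upair x y" "r \<tturnstile> z \<^bold>= upair a b"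
    then show "r \<tturnstile> z \<^bold>= opair x y" unfolding opair_def by (blast intro: eq_trans upair_cong)
  qed
next
  assume "p \<tturnstile> z \<^bold>= opair x y"
  then show "p \<tturnstile> fm_pair z x y"
    unfolding fm_pair_def opair_def
    by (intro forces_ExI[where x = "upair x x"] forces_ExI[where x = "upair x y"])
      (simp only: forces.simps(4) fm_upair_iff eq_refl simp_thms)
qed

text \<open>This reduces formulas about functions to membership of the canonical name
  \<open>opair x y\<close> and removes the quantifiers hidden in \<open>fm_pair_in\<close>.\<close>

lemma fm_pair_in_iff: "p \<tturnstile> fm_pair_in x y f \<longleftrightarrow> p \<tturnstile> opair x y \<^bold>\<in> f"
proof
  assume "p \<tturnstile> fm_pair_in x y f"
  then show "p \<tturnstile> opair x y \<^bold>\<in> f"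
    unfolding fm_pair_in_def
    by (elim forces_ExE) (auto simp only: forces.simps(4) fm_pair_iff intro: mem_cong1)
next
  assume "p \<tturnstile> opair x y \<^bold>\<in> f"
  then show "p \<tturnstile> fm_pair_in x y f"
    unfolding fm_pair_in_def
    by (intro forces_ExI[where x = "opair x y"]) (simp only: forces.simps(4) fm_pair_iff eq_refl simp_thms)
qed

lemma singleton_eq_upairD:
  assumes "p \<tturnstile> upair x x \<^bold>= upair a b"
  shows "p \<tturnstile> x \<^bold>= a"
proof -
  have "p \<tturnstile> a \<^bold>\<in> upair a b" unfolding mem_upair by (simp add: forces_OrI eq_refl)
  then have "p \<tturnstile> a \<^bold>\<in> upair x x" using assms mem_cong2 eq_sym by blast
  then show ?thesis using mem_singleton[of p a x] eq_sym by simp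
qed

lemma opair_injectD1:
  assumes "p \<tturnstile> opair x y \<^bold>= opair x' y'"
  shows "p \<tturnstile> x \<^bold>= x'"
proof -
  have "p \<tturnstile> upair x x \<^bold>\<in> opair x y" unfolding opair_def mem_upair by (simp add: forces_OrI eq_refl)
  then have "p \<tturnstile> upair x x \<^bold>\<in> opair x' y'" using assms mem_cong2 by blast
  then show ?thesis unfolding opair_def mem_upair
    by (elim forces_OrE)
      (use singleton_eq_upairD[of _ x x' x'] singleton_eq_upairD[of _ x x' y'] in simp_all)
qed

lemma opair_eq_mem_upair:
  assumes "p \<tturnstile> opair x y \<^bold>= opair x' y'"
  shows "p \<tturnstile> y \<^bold>\<in> upair x' y'"
proof -
  have "p \<tturnstile> upair x y \<^bold>\<in> opair x y" unfolding opair_def mem_upair by (simp add: forces_OrI eq_refl)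
  then have *: "p \<tturnstile> upair x y \<^bold>\<in> opair x' y'" using assms mem_cong2 by blast
  have y: "q \<tturnstile> y \<^bold>\<in> upair x y" for q unfolding mem_upair by (simp add: forces_OrI eq_refl)
  from * show ?thesis unfolding opair_def mem_upair[of _ "upair x y"]
  proof (elim forces_OrE)
    fix q assume "q \<tturnstile> upair x y \<^bold>= upair x' x'"
    then have "q \<tturnstile> y \<^bold>= x'" using y mem_cong2 mem_singleton[of q y x'] by (metis insert_absorb2)
    then show "q \<tturnstile> y \<^bold>\<in> upair x' y'" unfolding mem_upair by (simp add: forces_OrI)
  qed (use y mem_cong2 in blast)
qed

text \<open>Since \<open>y\<close> is in \<open>{x', y'}\<close>, only the case
  \<open>y = x'\<close> is open. There \<open>y = x' = x\<close>, while \<open>y'\<close> is in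
  \<open>{x, y}\<close> by symmetry, so both alternatives for \<open>y'\<close> give
  \<open>y' = y\<close>.\<close>

lemma opair_injectD2:
  assumes "p \<tturnstile> opair x y \<^bold>= opair x' y'"
  shows "p \<tturnstile> y \<^bold>= y'"
proof -
  have x: "p \<tturnstile> x \<^bold>= x'" using assms by (rule opair_injectD1)
  have "p \<tturnstile> y \<^bold>= x' \<^bold>\<or> y \<^bold>= y'" using opair_eq_mem_upair[OF assms] mem_upair by simp
  then show ?thesis
  proof (elim forces_OrE)
    fix q assume q: "q \<preceq> p" "q \<tturnstile> y \<^bold>= x'"
    have "q \<tturnstile> y' \<^bold>= x \<^bold>\<or> y' \<^bold>= y"
      using opair_eq_mem_upair[OF eq_sym[OF assms]] q mem_upair forces_mono by blast
    then show "q \<tturnstile> y \<^bold>= y'"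
    proof (elim forces_OrE)
      fix r assume "r \<preceq> q" "r \<tturnstile> y' \<^bold>= x"
      then show "r \<tturnstile> y \<^bold>= y'" using q x by (meson eq_mono eq_sym eq_trans)
    qed (rule eq_sym)
  qed
qed

subsection \<open>The natural numbers\<close>

text \<open>Self-membership equates the numeral, at a stronger condition, with one of its elements:
  a smaller numeral that then contains itself.\<close>

lemma nat_not_mem_self: "p \<preceq> p \<Longrightarrow> \<not> (p \<tturnstile> check_nat one n \<^bold>\<in> check_nat one n)"
proof (induction n arbitrary: p rule: less_induct)
  case (less n)
  show ?case
  proof
    assume *: "p \<tturnstile> check_nat one n \<^bold>\<in> check_nat one n"
    then obtain q k where q: "q \<preceq> p" "k < n" "q \<tturnstile> check_nat one n \<^bold>= check_nat one k"
      using is_check_obtain[OF is_check_nat _ less.prems] by blast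
    then have "q \<tturnstile> check_nat one k \<^bold>\<in> check_nat one k"
      using forces_mono[OF * q(1)] mem_cong[OF q(3) q(3)] by blast
    then show False using less.IH q leq_refl by blast
  qed
qed

lemma nat_mem_nat: "m < n \<Longrightarrow> p \<tturnstile> check_nat one m \<^bold>\<in> check_nat one n"
  by (rule is_check_memI[OF is_check_nat]) auto

text \<open>Of two distinct numerals one is an element of the other, so equality would produce
  self-membership.\<close>

lemma nat_eq_natD: "p \<preceq> p \<Longrightarrow> p \<tturnstile> check_nat one m \<^bold>= check_nat one n \<Longrightarrow> m = n"
  by (metis linorder_neqE_nat mem_cong2 nat_mem_nat nat_not_mem_self eq_sym)

definition check_omega :: "('i, 'p) name" where
  "check_omega = check_set one (range (check_nat one))"

lemma is_check_omega: "is_check check_omega (range (check_nat one))"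
  unfolding check_omega_def by (rule is_check_countable) simp

lemma nat_mem_omega: "p \<tturnstile> check_nat one n \<^bold>\<in> check_omega"
  by (rule is_check_memI[OF is_check_omega]) auto

lemma nat_zero_empty: "q \<preceq> q \<Longrightarrow> \<not> (q \<tturnstile> z \<^bold>\<in> check_nat one 0)"
  using is_check_mem[OF is_check_nat[of 0]] by auto

lemma mem_nat_Suc:
  "p \<tturnstile> z \<^bold>\<in> check_nat one (Suc n) \<longleftrightarrow> p \<tturnstile> z \<^bold>\<in> check_nat one n \<^bold>\<or> z \<^bold>= check_nat one n"
proof
  assume "p \<tturnstile> z \<^bold>\<in> check_nat one (Suc n)"
  then show "p \<tturnstile> z \<^bold>\<in> check_nat one n \<^bold>\<or> z \<^bold>= check_nat one n"
  proof (rule is_check_memE[OF is_check_nat])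
    fix q a assume "a \<in> check_nat one ` {..<Suc n}" and q: "q \<tturnstile> z \<^bold>= a"
    then obtain k where a: "a = check_nat one k" "k < n \<or> k = n" by fastforce
    show "q \<tturnstile> z \<^bold>\<in> check_nat one n \<^bold>\<or> z \<^bold>= check_nat one n"
      using a q mem_cong1[OF nat_mem_nat eq_sym] by (intro forces_OrI) blast
  qed
next
  assume "p \<tturnstile> z \<^bold>\<in> check_nat one n \<^bold>\<or> z \<^bold>= check_nat one n"
  then show "p \<tturnstile> z \<^bold>\<in> check_nat one (Suc n)"
  proof (elim forces_OrE)
    fix q assume "q \<tturnstile> z \<^bold>\<in> check_nat one n"
    then show "q \<tturnstile> z \<^bold>\<in> check_nat one (Suc n)"
    proof (rule is_check_memE[OF is_check_nat])
      fix r a assume "a \<in> check_nat one ` {..<n}" "r \<tturnstile> z \<^bold>= a"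
      then show "r \<tturnstile> z \<^bold>\<in> check_nat one (Suc n)"
        using mem_cong1[OF nat_mem_nat eq_sym] less_SucI by blast
    qed
  next
    fix q assume "q \<tturnstile> z \<^bold>= check_nat one n"
    then show "q \<tturnstile> z \<^bold>\<in> check_nat one (Suc n)"
      using mem_cong1[OF nat_mem_nat[OF lessI] eq_sym] by blast
  qed
qed

lemma fm_succ_iff:
  assumes "p \<tturnstile> x \<^bold>= check_nat one n"
  shows "p \<tturnstile> fm_succ x y \<longleftrightarrow> p \<tturnstile> y \<^bold>= check_nat one (Suc n)"
proof -
  have "(q \<tturnstile> z \<^bold>\<in> x \<^bold>\<or> z \<^bold>= x) = (q \<tturnstile> z \<^bold>\<in> check_nat one (Suc n))" if "q \<preceq> p" for q z
    unfolding mem_nat_Suc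
    by (intro forces_Or_cong mem_cong eq_cong eq_refl; use assms that eq_mono trans_Q in blast)
  then show ?thesis unfolding fm_succ_def forces.simps(5) forces_Iff eq_ext[of p y] by blast
qed

lemma forces_omega: "p \<tturnstile> fm_omega check_omega"
proof -
  have "p \<tturnstile> fm_inductive check_omega"
    unfolding fm_inductive_def forces.simps(4,5)
  proof (intro conjI allI forces_ImpI)
    show "p \<tturnstile> \<^bold>\<exists>x. fm_empty x \<^bold>\<and> x \<^bold>\<in> check_omega"
      by (rule forces_ExI[where x = "check_nat one 0"])
        (use nat_mem_omega nat_zero_empty leq_refl in \<open>auto simp: fm_empty_def forces.simps\<close>)
  next
    fix x q assume "q \<tturnstile> x \<^bold>\<in> check_omega"
    then show "q \<tturnstile> \<^bold>\<exists>y. fm_succ x y \<^bold>\<and> y \<^bold>\<in> check_omega"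
    proof (rule is_check_memE[OF is_check_omega])
      fix r a assume "a \<in> range (check_nat one)" "r \<tturnstile> x \<^bold>= a"
      then obtain n where "r \<tturnstile> x \<^bold>= check_nat one n" by blast
      then show "r \<tturnstile> \<^bold>\<exists>y. fm_succ x y \<^bold>\<and> y \<^bold>\<in> check_omega"
        by (intro forces_ExI[where x = "check_nat one (Suc n)"])
          (simp only: forces.simps(4) fm_succ_iff nat_mem_omega eq_refl simp_thms)
    qed
  qed
  \<comment> \<open>Minimality: an element of \<open>check_omega\<close> equals, densely, a numeral
    of the ground model, so ordinary induction on \<open>n\<close> reaches all of them.\<close>
  moreover have "q \<tturnstile> fm_subset check_omega v" if "q \<tturnstile> fm_inductive v" for q v
  proof -
    have *: "r \<tturnstile> check_nat one n \<^bold>\<in> v" if "r \<preceq> q" for r n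
      using that
    proof (induction n arbitrary: r)
      case 0
      have "r \<tturnstile> \<^bold>\<exists>x. fm_empty x \<^bold>\<and> x \<^bold>\<in> v"
        using \<open>q \<tturnstile> fm_inductive v\<close> 0 forces_mono unfolding fm_inductive_def forces.simps(4) by blast
      then show ?case
      proof (rule forces_ExE)
        fix r' x assume r': "r' \<tturnstile> fm_empty x \<^bold>\<and> x \<^bold>\<in> v"
        \<comment> \<open>The empty element of \<open>v\<close> is given by some name
          \<open>x\<close>. It equals the numeral 0 by extensionality, as neither has an element at
          any condition below \<open>r'\<close>.\<close>
        then have "\<not> (q' \<tturnstile> z \<^bold>\<in> x)" if "q' \<preceq> r'" for q' z
          using that unfolding fm_empty_def forces.simps(3-5) by blast
        moreover have "\<not> (q' \<tturnstile> z \<^bold>\<in> check_nat one 0)" if "q' \<preceq> r'" for q' z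
          using that by (rule nat_zero_empty[OF leq_refl(1)])
        ultimately have "r' \<tturnstile> x \<^bold>= check_nat one 0"
          unfolding eq_ext[of r' x] by (intro allI impI) (simp only:)
        then show "r' \<tturnstile> check_nat one 0 \<^bold>\<in> v"
          by (rule mem_cong1[rotated]) (use r' in \<open>simp add: forces.simps\<close>)
      qed
    next
      case (Suc n)
      have "r \<tturnstile> check_nat one n \<^bold>\<in> v \<^bold>\<longrightarrow> (\<^bold>\<exists>y. fm_succ (check_nat one n) y \<^bold>\<and> y \<^bold>\<in> v)"
        using \<open>q \<tturnstile> fm_inductive v\<close> Suc.prems forces_mono unfolding fm_inductive_def forces.simps(4,5) by blast
      from forces_ImpD[OF this Suc.IH[OF Suc.prems]] show ?case
      proof (rule forces_ExE)
        fix r' y assume "r' \<tturnstile> fm_succ (check_nat one n) y \<^bold>\<and> y \<^bold>\<in> v"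
        then show "r' \<tturnstile> check_nat one (Suc n) \<^bold>\<in> v"
          unfolding forces.simps(4) fm_succ_iff[OF eq_refl] using mem_cong1 by blast
      qed
    qed
    show ?thesis
      unfolding fm_subset_def forces.simps(5)
    proof (intro allI forces_ImpI, erule is_check_memE[OF is_check_omega])
      fix z r r' a assume "r \<preceq> q" "r' \<preceq> r" "a \<in> range (check_nat one)" and z: "r' \<tturnstile> z \<^bold>= a"
      then have "r' \<tturnstile> a \<^bold>\<in> v" using * trans_Q by blast
      then show "r' \<tturnstile> z \<^bold>\<in> v" using eq_sym[OF z] by (rule mem_cong1)
    qed
  qed
  ultimately show ?thesis unfolding fm_omega_def forces.simps(4,5) by (auto intro: forces_ImpI)
qed

text \<open>Functions, finite sequences and the set \<open>D\<close> of \<open>fm_positive_tree\<close> all have names of this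
  kind.\<close>

definition check_rel :: "(nat \<times> nat) set \<Rightarrow> ('i, 'p) name" where
  "check_rel G = check_set one ((\<lambda>(k, m). opair (check_nat one k) (check_nat one m)) ` G)"

lemma is_check_check_rel: "is_check (check_rel G) ((\<lambda>(k, m). opair (check_nat one k) (check_nat one m)) ` G)"
  unfolding check_rel_def by (rule is_check_countable) simp

text \<open>Absoluteness: if two pairs of numerals are forced equal, their components are the same
  numbers.\<close>

lemma check_rel_mem:
  assumes "p \<preceq> p"
  shows "p \<tturnstile> opair (check_nat one k) (check_nat one m) \<^bold>\<in> check_rel G \<longleftrightarrow> (k, m) \<in> G"
proof
  assume "p \<tturnstile> opair (check_nat one k) (check_nat one m) \<^bold>\<in> check_rel G"
  then obtain q k' m' where q: "q \<preceq> p" "(k', m') \<in> G"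
      "q \<tturnstile> opair (check_nat one k) (check_nat one m) \<^bold>= opair (check_nat one k') (check_nat one m')"
    by (rule is_check_obtain[OF is_check_check_rel _ assms]) auto
  then have "k = k'" "m = m'"
    using opair_injectD1 opair_injectD2 nat_eq_natD leq_refl by meson+
  with q show "(k, m) \<in> G" by simp
qed (auto intro: is_check_memI[OF is_check_check_rel])

lemma check_rel_memE:
  assumes "p \<tturnstile> x \<^bold>\<in> check_rel G"
    "\<And>q k m. q \<preceq> p \<Longrightarrow> (k, m) \<in> G \<Longrightarrow> q \<tturnstile> x \<^bold>= opair (check_nat one k) (check_nat one m) \<Longrightarrow> q \<tturnstile> \<psi>"
  shows "p \<tturnstile> \<psi>"
  using assms(1) by (rule is_check_memE[OF is_check_check_rel]) (use assms(2) in fast)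

lemma forced_subset_iff: "p \<tturnstile> fm_subset x y \<longleftrightarrow> (\<forall>q z. q \<preceq> p \<longrightarrow> q \<tturnstile> z \<^bold>\<in> x \<longrightarrow> q \<tturnstile> z \<^bold>\<in> y)"
  unfolding fm_subset_def forces.simps(5) forces_Imp by blast

lemma check_rel_subset:
  assumes "p \<preceq> p"
  shows "p \<tturnstile> fm_subset (check_rel G) (check_rel H) \<longleftrightarrow> G \<subseteq> H"
proof
  assume "p \<tturnstile> fm_subset (check_rel G) (check_rel H)"
  then have "p \<tturnstile> z \<^bold>\<in> check_rel G \<Longrightarrow> p \<tturnstile> z \<^bold>\<in> check_rel H" for z
    using assms unfolding forced_subset_iff by blast
  then show "G \<subseteq> H" using check_rel_mem[OF assms] by (metis subrelI)
next
  assume "G \<subseteq> H"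
  then show "p \<tturnstile> fm_subset (check_rel G) (check_rel H)"
    unfolding forced_subset_iff
  proof (intro allI impI, elim check_rel_memE)
    fix q z r k m assume "r \<preceq> q" "(k, m) \<in> G" "r \<tturnstile> z \<^bold>= opair (check_nat one k) (check_nat one m)"
    then show "r \<tturnstile> z \<^bold>\<in> check_rel H"
      using \<open>G \<subseteq> H\<close> mem_cong1[OF _ eq_sym] check_rel_mem[OF leq_refl(1)] by (metis subsetD)
  qed
qed

lemma check_rel_eq: "p \<preceq> p \<Longrightarrow> p \<tturnstile> check_rel G \<^bold>= check_rel H \<longleftrightarrow> G = H"
  using check_rel_subset eq_refl unfolding forced_subset_iff eq_ext by (metis subset_antisym subset_refl)

subsection \<open>Functions, finite sets and sequences\<close>

lemma function_memE:
  assumes "p \<tturnstile> fm_function f A B" "p \<tturnstile> z \<^bold>\<in> f"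
    and "\<And>q x y. q \<preceq> p \<Longrightarrow> q \<tturnstile> x \<^bold>\<in> A \<Longrightarrow> q \<tturnstile> y \<^bold>\<in> B \<Longrightarrow> q \<tturnstile> z \<^bold>= opair x y \<Longrightarrow> q \<tturnstile> \<psi>"
  shows "p \<tturnstile> \<psi>"
proof -
  have "p \<tturnstile> z \<^bold>\<in> f \<^bold>\<longrightarrow> (\<^bold>\<exists>x. \<^bold>\<exists>y. x \<^bold>\<in> A \<^bold>\<and> y \<^bold>\<in> B \<^bold>\<and> fm_pair z x y)"
    using assms(1) unfolding fm_function_def forces.simps(4,5) by blast
  from forces_ImpD[OF this assms(2)] show ?thesis
    by (elim forces_ExE) (use assms(3) trans_Q in \<open>auto simp: forces.simps(4) fm_pair_iff\<close>)
qed

lemma function_valE: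
  assumes "p \<tturnstile> fm_function f A B" "p \<tturnstile> x \<^bold>\<in> A"
    and "\<And>q y. q \<preceq> p \<Longrightarrow> q \<tturnstile> opair x y \<^bold>\<in> f \<Longrightarrow> q \<tturnstile> \<psi>"
  shows "p \<tturnstile> \<psi>"
proof -
  have "p \<tturnstile> x \<^bold>\<in> A \<^bold>\<longrightarrow> (\<^bold>\<exists>y. fm_pair_in x y f)"
    using assms(1) unfolding fm_function_def forces.simps(4,5) by blast
  from forces_ImpD[OF this assms(2)] show ?thesis
    by (elim forces_ExE) (use assms(3) in \<open>auto simp: fm_pair_in_iff\<close>)
qed

lemma function_unique:
  assumes "p \<tturnstile> fm_function f A B" "p \<tturnstile> opair x y \<^bold>\<in> f" "p \<tturnstile> opair x y' \<^bold>\<in> f"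
  shows "p \<tturnstile> y \<^bold>= y'"
proof -
  have "p \<tturnstile> fm_pair_in x y f \<^bold>\<and> fm_pair_in x y' f \<^bold>\<longrightarrow> y \<^bold>= y'"
    using assms(1) unfolding fm_function_def forces.simps(4,5) by blast
  then show ?thesis by (rule forces_ImpD) (use assms in \<open>simp add: forces.simps(4) fm_pair_in_iff\<close>)
qed

lemma functionI:
  assumes "\<And>q z. q \<preceq> p \<Longrightarrow> q \<tturnstile> z \<^bold>\<in> f \<Longrightarrow> q \<tturnstile> \<^bold>\<exists>x. \<^bold>\<exists>y. x \<^bold>\<in> A \<^bold>\<and> y \<^bold>\<in> B \<^bold>\<and> fm_pair z x y"
    and "\<And>q x. q \<preceq> p \<Longrightarrow> q \<tturnstile> x \<^bold>\<in> A \<Longrightarrow> q \<tturnstile> \<^bold>\<exists>y. fm_pair_in x y f"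
    and "\<And>q x y y'. q \<preceq> p \<Longrightarrow> q \<tturnstile> opair x y \<^bold>\<in> f \<Longrightarrow> q \<tturnstile> opair x y' \<^bold>\<in> f \<Longrightarrow> q \<tturnstile> y \<^bold>= y'"
  shows "p \<tturnstile> fm_function f A B"
  unfolding fm_function_def forces.simps(4,5)
  by (intro conjI allI forces_ImpI; (unfold forces.simps(4) fm_pair_in_iff)?;
    blast intro: assms[unfolded fm_pair_in_iff])

lemma function_mem_codomain:
  assumes "p \<tturnstile> fm_function f A B" "p \<tturnstile> opair x y \<^bold>\<in> f"
  shows "p \<tturnstile> y \<^bold>\<in> B"
  by (rule function_memE[OF assms]) (blast intro: mem_cong1 eq_sym opair_injectD2)

lemma injectiveD:
  assumes "p \<tturnstile> fm_injective f" "p \<tturnstile> opair x y \<^bold>\<in> f" "p \<tturnstile> opair x' y \<^bold>\<in> f"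
  shows "p \<tturnstile> x \<^bold>= x'"
proof -
  have "p \<tturnstile> fm_pair_in x y f \<^bold>\<and> fm_pair_in x' y f \<^bold>\<longrightarrow> x \<^bold>= x'"
    using assms(1) unfolding fm_injective_def forces.simps(4,5) by blast
  then show ?thesis by (rule forces_ImpD) (use assms in \<open>simp add: forces.simps(4) fm_pair_in_iff\<close>)
qed

text \<open>A finite sequence of arbitrary names. It serves as the bijection that
  \<open>fm_finite\<close> asks for and, with numerals as values, as the check name of a finite
  sequence of numbers.\<close>

definition enum_fun :: "(nat \<Rightarrow> ('i, 'p) name) \<Rightarrow> nat \<Rightarrow> ('i, 'p) name" where
  "enum_fun x n = check_set one ((\<lambda>i. opair (check_nat one i) (x i)) ` {..<n})"

lemma enum_fun_memI: "i < n \<Longrightarrow> p \<tturnstile> opair (check_nat one i) (x i) \<^bold>\<in> enum_fun x n"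
  unfolding enum_fun_def by (rule is_check_memI[OF is_check_countable]) auto

lemma enum_fun_memE:
  assumes "p \<tturnstile> z \<^bold>\<in> enum_fun x n"
    "\<And>q i. q \<preceq> p \<Longrightarrow> i < n \<Longrightarrow> q \<tturnstile> z \<^bold>= opair (check_nat one i) (x i) \<Longrightarrow> q \<tturnstile> \<psi>"
  shows "p \<tturnstile> \<psi>"
  using assms(1) unfolding enum_fun_def
  by (rule is_check_memE[OF is_check_countable, rotated]) (use assms(2) in auto)

lemma enum_fun_pairE:
  assumes "p \<tturnstile> opair a b \<^bold>\<in> enum_fun x n"
    "\<And>q i. q \<preceq> p \<Longrightarrow> i < n \<Longrightarrow> q \<tturnstile> a \<^bold>= check_nat one i \<Longrightarrow> q \<tturnstile> b \<^bold>= x i \<Longrightarrow> q \<tturnstile> \<psi>"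
  shows "p \<tturnstile> \<psi>"
  using assms(1) by (rule enum_fun_memE) (use assms(2) opair_injectD1 opair_injectD2 in blast)

lemma enum_fun_function:
  assumes "\<And>i q. i < n \<Longrightarrow> q \<preceq> p \<Longrightarrow> q \<tturnstile> x i \<^bold>\<in> B"
  shows "p \<tturnstile> fm_function (enum_fun x n) (check_nat one n) B"
proof (rule functionI)
  fix q z assume "q \<preceq> p" "q \<tturnstile> z \<^bold>\<in> enum_fun x n"
  from this(2) show "q \<tturnstile> \<^bold>\<exists>a. \<^bold>\<exists>b. a \<^bold>\<in> check_nat one n \<^bold>\<and> b \<^bold>\<in> B \<^bold>\<and> fm_pair z a b"
  proof (rule enum_fun_memE)
    fix r i assume "r \<preceq> q" "i < n" "r \<tturnstile> z \<^bold>= opair (check_nat one i) (x i)"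
    then show "r \<tturnstile> \<^bold>\<exists>a. \<^bold>\<exists>b. a \<^bold>\<in> check_nat one n \<^bold>\<and> b \<^bold>\<in> B \<^bold>\<and> fm_pair z a b"
      using assms \<open>q \<preceq> p\<close> trans_Q nat_mem_nat
      by (intro forces_ExI[where x = "check_nat one i"] forces_ExI[where x = "x i"])
        (simp add: forces.simps(4) fm_pair_iff)
  qed
next
  fix q a assume "q \<tturnstile> a \<^bold>\<in> check_nat one n"
  then show "q \<tturnstile> \<^bold>\<exists>y. fm_pair_in a y (enum_fun x n)"
  proof (rule is_check_memE[OF is_check_nat], elim imageE)
    fix r b i assume "r \<tturnstile> a \<^bold>= b" "b = check_nat one i" "i \<in> {..<n}"
    then have "r \<tturnstile> opair a (x i) \<^bold>\<in> enum_fun x n"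
      using enum_fun_memI[of i n r x] mem_cong1 opair_cong eq_refl eq_sym by (metis lessThan_iff)
    then show "r \<tturnstile> \<^bold>\<exists>y. fm_pair_in a y (enum_fun x n)"
      by (intro forces_ExI[where x = "x i"]) (simp add: fm_pair_in_iff)
  qed
next
  fix q a y y' assume "q \<tturnstile> opair a y \<^bold>\<in> enum_fun x n" and *: "q \<tturnstile> opair a y' \<^bold>\<in> enum_fun x n"
  from this(1) show "q \<tturnstile> y \<^bold>= y'"
  proof (rule enum_fun_pairE)
    fix r i assume r: "r \<preceq> q" "i < n" "r \<tturnstile> a \<^bold>= check_nat one i" "r \<tturnstile> y \<^bold>= x i"
    from forces_mono[OF * r(1)] show "r \<tturnstile> y \<^bold>= y'"
    proof (rule enum_fun_pairE)
      fix r' j assume r': "r' \<preceq> r" "j < n" "r' \<tturnstile> a \<^bold>= check_nat one j" "r' \<tturnstile> y' \<^bold>= x j"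
      then have "r' \<tturnstile> check_nat one i \<^bold>= check_nat one j" using r eq_mono eq_sym eq_trans by meson
      then have "i = j" using r' leq_refl nat_eq_natD by blast
      then show "r' \<tturnstile> y \<^bold>= y'" using r r' eq_mono eq_sym eq_trans by metis
    qed
  qed
qed

lemma enum_fun_injective:
  assumes "\<And>i j q. i < n \<Longrightarrow> j < n \<Longrightarrow> q \<preceq> p \<Longrightarrow> q \<tturnstile> x i \<^bold>= x j \<Longrightarrow> i = j"
  shows "p \<tturnstile> fm_injective (enum_fun x n)"
  unfolding fm_injective_def forces.simps(5)
proof (intro allI forces_ImpI, unfold forces.simps(4) fm_pair_in_iff, elim conjE)
  fix q a a' y assume "q \<preceq> p" "q \<tturnstile> opair a y \<^bold>\<in> enum_fun x n" and *: "q \<tturnstile> opair a' y \<^bold>\<in> enum_fun x n"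
  from this(2) show "q \<tturnstile> a \<^bold>= a'"
  proof (rule enum_fun_pairE)
    fix r i assume r: "r \<preceq> q" "i < n" "r \<tturnstile> a \<^bold>= check_nat one i" "r \<tturnstile> y \<^bold>= x i"
    from forces_mono[OF * r(1)] show "r \<tturnstile> a \<^bold>= a'"
    proof (rule enum_fun_pairE)
      fix r' j assume r': "r' \<preceq> r" "j < n" "r' \<tturnstile> a' \<^bold>= check_nat one j" "r' \<tturnstile> y \<^bold>= x j"
      then have "r' \<tturnstile> x i \<^bold>= x j" using r eq_mono eq_sym eq_trans by meson
      then have "i = j" using assms r r' \<open>q \<preceq> p\<close> trans_Q by blast
      then show "r' \<tturnstile> a \<^bold>= a'" using r r' eq_mono eq_sym eq_trans by metis
    qed
  qed
qed

lemma enum_fun_onto: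
  assumes "is_check B (x ` {..<n})"
  shows "p \<tturnstile> fm_onto (enum_fun x n) B"
  unfolding fm_onto_def forces.simps(5)
proof (intro allI forces_ImpI)
  fix q y assume "q \<tturnstile> y \<^bold>\<in> B"
  then show "q \<tturnstile> \<^bold>\<exists>a. fm_pair_in a y (enum_fun x n)"
  proof (rule is_check_memE[OF assms], elim imageE)
    fix r b i assume "r \<tturnstile> y \<^bold>= b" "b = x i" "i \<in> {..<n}"
    then have "r \<tturnstile> opair (check_nat one i) y \<^bold>\<in> enum_fun x n"
      using enum_fun_memI[of i n r x] mem_cong1 opair_cong eq_refl eq_sym by (metis lessThan_iff)
    then show "r \<tturnstile> \<^bold>\<exists>a. fm_pair_in a y (enum_fun x n)"
      by (intro forces_ExI[where x = "check_nat one i"]) (simp add: fm_pair_in_iff)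
  qed
qed

text \<open>The enumeration of \<open>S\<close> must be forced injective, but distinct names may be
  forced equal; the second premise excludes this. It holds for the canonical names to which the
  lemma is applied.\<close>

lemma finite_check_set:
  assumes "finite S" "\<And>a b q. a \<in> S \<Longrightarrow> b \<in> S \<Longrightarrow> q \<preceq> p \<Longrightarrow> q \<tturnstile> a \<^bold>= b \<Longrightarrow> a = b"
  shows "p \<tturnstile> fm_finite check_omega (check_set one S)"
proof -
  obtain x where "bij_betw x {..<card S} S"
    using assms(1) ex_bij_betw_nat_finite atLeast0LessThan by metis
  then have S: "S = x ` {..<card S}" and inj: "inj_on x {..<card S}" unfolding bij_betw_def by auto
  have check: "is_check (check_set one S) (x ` {..<card S})"
    using is_check_countable[OF countable_finite[OF assms(1)]] S by simp
  have "p \<tturnstile> fm_function (enum_fun x (card S)) (check_nat one (card S)) (check_set one S)"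
    by (intro enum_fun_function is_check_memI[OF check]) auto
  moreover have "p \<tturnstile> fm_injective (enum_fun x (card S))"
    using assms(2) S inj_onD[OF inj] by (intro enum_fun_injective) blast
  moreover have "p \<tturnstile> fm_onto (enum_fun x (card S)) (check_set one S)"
    using check by (rule enum_fun_onto)
  ultimately show ?thesis
    unfolding fm_finite_def
    by (intro forces_ExI[where x = "check_nat one (card S)"] forces_ExI[where x = "enum_fun x (card S)"])
      (simp add: forces.simps(4) nat_mem_omega)
qed

section \<open>Finite sequences of the extension\<close>

abbreviation check_seq :: "nat list \<Rightarrow> ('i, 'p) name" where
  "check_seq s \<equiv> check_rel (graph_seq s)"

lemma check_seq_enum: "check_seq s = enum_fun (\<lambda>i. check_nat one (s ! i)) (length s)"
  unfolding check_rel_def enum_fun_def graph_seq_def by (rule arg_cong[of _ _ "check_set one"]) auto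

lemma check_seq_seq: "p \<tturnstile> fm_seq check_omega (check_seq s)"
  unfolding fm_seq_def
proof (rule forces_ExI[where x = "check_nat one (length s)"], unfold forces.simps(4), intro conjI)
  show "p \<tturnstile> fm_function (check_seq s) (check_nat one (length s)) check_omega"
    unfolding check_seq_enum by (intro enum_fun_function nat_mem_omega)
qed (rule nat_mem_omega)

text \<open>The values are decided one at a time, each by strengthening the condition; after
  finitely many steps a single condition has decided them all.\<close>

lemma seq_decide_prefix:
  assumes "q \<preceq> q" "q \<tturnstile> fm_function t N check_omega" "q \<tturnstile> N \<^bold>= check_nat one n" "j \<le> n"
  shows "\<exists>r s. r \<preceq> q \<and> length s = j \<and> (\<forall>i<j. r \<tturnstile> opair (check_nat one i) (check_nat one (s ! i)) \<^bold>\<in> t)"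
  using assms(4)
proof (induction j)
  case 0
  then show ?case using assms(1) by auto
next
  case (Suc j)
  then obtain r s where r: "r \<preceq> q" "length s = j"
      "\<And>i. i < j \<Longrightarrow> r \<tturnstile> opair (check_nat one i) (check_nat one (s ! i)) \<^bold>\<in> t" by auto
  have fn: "r \<tturnstile> fm_function t N check_omega" using assms(2) r(1) by (rule forces_mono)
  have "r \<tturnstile> N \<^bold>= check_nat one n" using assms(3) r(1) by (rule forces_mono)
  then have jN: "r \<tturnstile> check_nat one j \<^bold>\<in> N"
    using mem_cong2[OF nat_mem_nat eq_sym, of j n] Suc.prems by simp
  have "r \<tturnstile> \<^bold>\<exists>y. opair (check_nat one j) y \<^bold>\<in> t \<^bold>\<and> y \<^bold>\<in> check_omega"
  proof (rule function_valE[OF fn jN])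
    fix r' y assume r': "r' \<preceq> r" "r' \<tturnstile> opair (check_nat one j) y \<^bold>\<in> t"
    then have "r' \<tturnstile> y \<^bold>\<in> check_omega" using function_mem_codomain forces_mono[OF fn] by blast
    with r' show "r' \<tturnstile> \<^bold>\<exists>y. opair (check_nat one j) y \<^bold>\<in> t \<^bold>\<and> y \<^bold>\<in> check_omega"
      by (intro forces_ExI) (auto simp: forces.simps(4))
  qed
  then obtain r1 y where r1: "r1 \<preceq> r" "r1 \<tturnstile> opair (check_nat one j) y \<^bold>\<in> t" "r1 \<tturnstile> y \<^bold>\<in> check_omega"
    unfolding forces_Ex forces.simps(4) using leq_refl(1)[OF r(1)] by blast
  then obtain r2 m where r2: "r2 \<preceq> r1" "r2 \<tturnstile> y \<^bold>= check_nat one m"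
    using is_check_obtain[OF is_check_omega r1(3) leq_refl(1)] by blast
  have "r2 \<tturnstile> opair (check_nat one j) (check_nat one m) \<^bold>\<in> t"
    using mem_cong1[OF forces_mono[OF r1(2) r2(1)] opair_cong[OF eq_refl r2(2)]] .
  moreover have "r2 \<preceq> r" using r1 r2 trans_Q by blast
  ultimately show ?case
    using r forces_mono trans_Q
    by (intro exI[of _ r2] exI[of _ "s @ [m]"]) (auto simp: nth_append less_Suc_eq)
qed

text \<open>Forcing adds no finite sequences: one condition decides the length, a stronger one all
  values. Names of nodes can therefore be replaced by lists.\<close>

lemma seq_decide:
  assumes "p \<preceq> p" "p \<tturnstile> fm_seq check_omega t"
  obtains r s where "r \<preceq> p" "r \<tturnstile> t \<^bold>= check_seq s"
proof -
  obtain q N where q: "q \<preceq> p" "q \<tturnstile> N \<^bold>\<in> check_omega" "q \<tturnstile> fm_function t N check_omega"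
    using assms unfolding fm_seq_def forces_Ex forces.simps(4) by blast
  then obtain r n where r: "r \<preceq> q" "r \<tturnstile> N \<^bold>= check_nat one n"
    using is_check_obtain[OF is_check_omega q(2) leq_refl(1)] by blast
  obtain r' s where r': "r' \<preceq> r" "length s = n"
    and s: "\<And>i. i < n \<Longrightarrow> r' \<tturnstile> opair (check_nat one i) (check_nat one (s ! i)) \<^bold>\<in> t"
    using seq_decide_prefix[OF leq_refl(1)[OF r(1)] forces_mono[OF q(3) r(1)] r(2) order_refl]
    by blast
  have fn: "r' \<tturnstile> fm_function t N check_omega" using q(3) r(1) r'(1) forces_mono by blast
  have N: "r' \<tturnstile> N \<^bold>= check_nat one n" using r(2) r'(1) by (rule forces_mono)
  have "r' \<tturnstile> t \<^bold>= check_seq s"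
  proof (rule eqI)
    fix q z assume q: "q \<preceq> r'" "q \<tturnstile> z \<^bold>\<in> t"
    from forces_mono[OF fn q(1)] q(2) show "q \<tturnstile> z \<^bold>\<in> check_seq s"
    proof (rule function_memE)
      fix q1 x y assume q1: "q1 \<preceq> q" "q1 \<tturnstile> x \<^bold>\<in> N" "q1 \<tturnstile> z \<^bold>= opair x y"
      have q1r': "q1 \<preceq> r'" using q1 q trans_Q by blast
      have "q1 \<tturnstile> x \<^bold>\<in> check_nat one n"
        using mem_cong2[OF q1(2) forces_mono[OF N q1r']] .
      then show "q1 \<tturnstile> z \<^bold>\<in> check_seq s"
      proof (rule is_check_memE[OF is_check_nat], elim imageE)
        fix q2 a i assume q2: "q2 \<preceq> q1" "q2 \<tturnstile> x \<^bold>= a" "a = check_nat one i" "i \<in> {..<n}"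
        have q2r': "q2 \<preceq> r'" using q2 q1r' trans_Q by blast
        have z: "q2 \<tturnstile> z \<^bold>= opair (check_nat one i) y"
          using eq_trans[OF forces_mono[OF q1(3) q2(1)] opair_cong[OF _ eq_refl]] q2 by blast
        have "q2 \<tturnstile> z \<^bold>\<in> t" using q(2) q1(1) q2(1) forces_mono by blast
        then have "q2 \<tturnstile> opair (check_nat one i) y \<^bold>\<in> t" using z by (rule mem_cong1)
        moreover have "q2 \<tturnstile> opair (check_nat one i) (check_nat one (s ! i)) \<^bold>\<in> t"
          using s q2 forces_mono[OF _ q2r'] by blast
        \<comment> \<open>Both \<open>y\<close> and the decided value are images of
          \<open>i\<close>, so single-valuedness of \<open>t\<close> identifies them.\<close>
        ultimately have "q2 \<tturnstile> y \<^bold>= check_nat one (s ! i)"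
          by (rule function_unique[OF forces_mono[OF fn q2r']])
        then have "q2 \<tturnstile> z \<^bold>= opair (check_nat one i) (check_nat one (s ! i))"
          using eq_trans[OF z opair_cong[OF eq_refl]] by blast
        moreover have "q2 \<tturnstile> opair (check_nat one i) (check_nat one (s ! i)) \<^bold>\<in> check_seq s"
          using check_rel_mem[OF leq_refl(1)[OF q2(1)]] graph_seq_mem q2(4) r'(2) by blast
        ultimately show "q2 \<tturnstile> z \<^bold>\<in> check_seq s" using mem_cong1 eq_sym by blast
      qed
    qed
  next
    fix q z assume q: "q \<preceq> r'" "q \<tturnstile> z \<^bold>\<in> check_seq s"
    from q(2) show "q \<tturnstile> z \<^bold>\<in> t"
    proof (rule check_rel_memE)
      fix q' k m assume q': "q' \<preceq> q" "(k, m) \<in> graph_seq s" "q' \<tturnstile> z \<^bold>= opair (check_nat one k) (check_nat one m)"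
      then have "r' \<tturnstile> opair (check_nat one k) (check_nat one m) \<^bold>\<in> t"
        using s[of k] r'(2) by (auto simp: graph_seq_mem)
      then have "q' \<tturnstile> opair (check_nat one k) (check_nat one m) \<^bold>\<in> t"
        using q(1) q'(1) forces_mono by blast
      then show "q' \<tturnstile> z \<^bold>\<in> t" using eq_sym[OF q'(3)] by (rule mem_cong1)
    qed
  qed
  moreover have "r' \<preceq> p" using q r r' trans_Q by blast
  ultimately show thesis using that by blast
qed

lemma check_seq_injectiveD:
  assumes "p \<preceq> p" "p \<tturnstile> fm_injective (check_seq s)"
  shows "distinct s"
  unfolding distinct_conv_nth
proof (intro allI impI notI)
  fix i j assume *: "i < length s" "j < length s" "i \<noteq> j" "s ! i = s ! j"
  then have "p \<tturnstile> opair (check_nat one i) (check_nat one (s ! i)) \<^bold>\<in> check_seq s"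
    "p \<tturnstile> opair (check_nat one j) (check_nat one (s ! i)) \<^bold>\<in> check_seq s"
    unfolding check_rel_mem[OF assms(1)] graph_seq_mem by auto
  then show False using injectiveD[OF assms(2)] nat_eq_natD[OF assms(1)] * by blast
qed

lemma subset_cong:
  assumes "p \<tturnstile> x \<^bold>= x'" "p \<tturnstile> y \<^bold>= y'"
  shows "p \<tturnstile> fm_subset x y \<longleftrightarrow> p \<tturnstile> fm_subset x' y'"
  using assms unfolding forced_subset_iff eq_ext by metis

lemma forced_strict_ext_iff: "p \<tturnstile> fm_strict_ext x y \<longleftrightarrow>
    p \<tturnstile> fm_subset x y \<and> (\<forall>q. q \<preceq> p \<longrightarrow> \<not> (q \<tturnstile> x \<^bold>= y))"
  unfolding fm_strict_ext_def forces.simps(3,4) ..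

lemma strict_ext_cong:
  assumes "p \<tturnstile> x \<^bold>= x'" "p \<tturnstile> y \<^bold>= y'"
  shows "p \<tturnstile> fm_strict_ext x y \<longleftrightarrow> p \<tturnstile> fm_strict_ext x' y'"
  unfolding forced_strict_ext_iff subset_cong[OF assms]
  using eq_cong[OF forces_mono[OF assms(1)] forces_mono[OF assms(2)]] by blast

lemma check_seq_strict_ext:
  assumes "p \<preceq> p"
  shows "p \<tturnstile> fm_strict_ext (check_seq s) (check_seq t) \<longleftrightarrow> strict_prefix s t"
proof -
  have "(\<forall>q. q \<preceq> p \<longrightarrow> \<not> (q \<tturnstile> check_seq s \<^bold>= check_seq t)) \<longleftrightarrow> s \<noteq> t"
    using check_rel_eq[OF leq_refl(1)] graph_seq_eq assms by metis
  then show ?thesis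
    unfolding forced_strict_ext_iff check_rel_subset[OF assms] graph_seq_subset strict_prefix_def by blast
qed

subsection \<open>Trees\<close>

lemma tree_seq:
  assumes "p \<tturnstile> fm_tree check_omega T" "p \<tturnstile> t \<^bold>\<in> T"
  shows "p \<tturnstile> fm_seq check_omega t"
proof -
  have "p \<tturnstile> t \<^bold>\<in> T \<^bold>\<longrightarrow> fm_seq check_omega t"
    using assms(1) unfolding fm_tree_def forces.simps(4,5) by blast
  then show ?thesis using assms(2) by (rule forces_ImpD)
qed

lemma tree_decide:
  assumes "p \<tturnstile> fm_tree check_omega T" "p \<tturnstile> t \<^bold>\<in> T" "p \<preceq> p"
  obtains r s where "r \<preceq> p" "r \<tturnstile> t \<^bold>= check_seq s" "r \<tturnstile> check_seq s \<^bold>\<in> T"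
  using seq_decide[OF assms(3) tree_seq[OF assms(1,2)]] mem_cong1 forces_mono[OF assms(2)] by metis

lemma tree_prefix:
  assumes "p \<tturnstile> fm_tree check_omega T" "p \<tturnstile> check_seq t \<^bold>\<in> T" "prefix s t"
  shows "p \<tturnstile> check_seq s \<^bold>\<in> T"
\<comment> \<open>Passing to \<open>q\<close> below \<open>p\<close> supplies a genuine condition,
  as \<open>check_rel_subset\<close> requires; \<open>p\<close> itself is not assumed to be
  one.\<close>
proof (rule forces_dense)
  fix q assume q: "q \<preceq> p"
  have closed: "p \<tturnstile> check_seq t \<^bold>\<in> T \<^bold>\<and> fm_seq check_omega (check_seq s) \<^bold>\<and> fm_subset (check_seq s) (check_seq t) \<^bold>\<longrightarrow> check_seq s \<^bold>\<in> T"
    using assms(1) unfolding fm_tree_def forces.simps(4,5) by blast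
  have "q \<tturnstile> fm_subset (check_seq s) (check_seq t)"
    unfolding check_rel_subset[OF leq_refl(1)[OF q]] graph_seq_subset by (rule assms(3))
  then have "q \<tturnstile> check_seq s \<^bold>\<in> T"
    by (intro forces_ImpD[OF forces_mono[OF closed q]])
      (simp add: forces.simps(4) forces_mono[OF assms(2) q] check_seq_seq)
  then show "\<exists>r. r \<preceq> q \<and> (r \<tturnstile> check_seq s \<^bold>\<in> T)" using leq_refl(1)[OF q] by blast
qed

lemma tree_extend:
  assumes "p \<tturnstile> fm_tree check_omega T" "p \<tturnstile> check_seq t \<^bold>\<in> T" "p \<preceq> p"
  obtains r s where "r \<preceq> p" "strict_prefix t s" "r \<tturnstile> check_seq s \<^bold>\<in> T"
proof -
  have "p \<tturnstile> check_seq t \<^bold>\<in> T \<^bold>\<longrightarrow> (\<^bold>\<exists>s. s \<^bold>\<in> T \<^bold>\<and> fm_strict_ext (check_seq t) s)"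
    using assms(1) unfolding fm_tree_def forces.simps(4,5) by blast
  from forces_ImpD[OF this assms(2)] assms(3)
  obtain q u where q: "q \<preceq> p" "q \<tturnstile> u \<^bold>\<in> T" "q \<tturnstile> fm_strict_ext (check_seq t) u"
    unfolding forces_Ex forces.simps(4) by blast
  obtain r s where r: "r \<preceq> q" "r \<tturnstile> u \<^bold>= check_seq s" "r \<tturnstile> check_seq s \<^bold>\<in> T"
    using tree_decide[OF forces_mono[OF assms(1) q(1)] q(2) leq_refl(1)[OF q(1)]] .
  have "r \<tturnstile> fm_strict_ext (check_seq t) (check_seq s)"
    using forces_mono[OF q(3) r(1)] strict_ext_cong[OF eq_refl r(2)] by blast
  then have "strict_prefix t s" using check_seq_strict_ext[OF leq_refl(1)[OF r(1)]] by blast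
  moreover have "r \<preceq> p" using q(1) r(1) trans_Q by blast
  ultimately show thesis using that r(3) by blast
qed

section \<open>Unions of graphs and positivity\<close>

lemma check_fun_eq: "check_fun one f = check_rel (graph_fun f)"
  unfolding check_fun_def check_rel_def graph_fun_def check_pair_eq image_image by simp

lemma is_check_family: "is_check (check_family one X) (check_fun one ` X)"
  unfolding check_family_def by (rule is_check_set[OF small_image])

lemma in_Union_iff:
  assumes "p \<preceq> p"
  shows "p \<tturnstile> fm_in_Union (opair (check_nat one k) (check_nat one m)) (check_family one X)
    \<longleftrightarrow> (k, m) \<in> \<Union>(graph_fun ` X)"
proof
  assume "p \<tturnstile> fm_in_Union (opair (check_nat one k) (check_nat one m)) (check_family one X)"
  then obtain q h where q: "q \<preceq> p" "q \<tturnstile> h \<^bold>\<in> check_family one X"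
    "q \<tturnstile> opair (check_nat one k) (check_nat one m) \<^bold>\<in> h"
    using assms unfolding fm_in_Union_def forces_Ex forces.simps(4) by blast
  then obtain r f where r: "r \<preceq> q" "f \<in> X" "r \<tturnstile> h \<^bold>= check_rel (graph_fun f)"
    using is_check_obtain[OF is_check_family q(2) leq_refl(1)[OF q(1)]] check_fun_eq by (metis imageE)
  have "r \<tturnstile> opair (check_nat one k) (check_nat one m) \<^bold>\<in> check_rel (graph_fun f)"
    using mem_cong2[OF forces_mono[OF q(3) r(1)] r(3)] .
  then show "(k, m) \<in> \<Union>(graph_fun ` X)"
    using check_rel_mem[OF leq_refl(1)[OF r(1)]] r(2) by blast
next
  assume "(k, m) \<in> \<Union>(graph_fun ` X)"
  then obtain f where f: "f \<in> X" "(k, m) \<in> graph_fun f" by blast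
  show "p \<tturnstile> fm_in_Union (opair (check_nat one k) (check_nat one m)) (check_family one X)"
    unfolding fm_in_Union_def
  proof (rule forces_ExI[where x = "check_fun one f"], unfold forces.simps(4), intro conjI)
    show "p \<tturnstile> check_fun one f \<^bold>\<in> check_family one X"
      using f(1) by (intro is_check_memI[OF is_check_family]) blast
    show "p \<tturnstile> opair (check_nat one k) (check_nat one m) \<^bold>\<in> check_fun one f"
      unfolding check_fun_eq check_rel_mem[OF assms] by (rule f(2))
  qed
qed

lemma in_Union_cong:
  assumes "p \<tturnstile> z \<^bold>= z'" "p \<tturnstile> fm_in_Union z X"
  shows "p \<tturnstile> fm_in_Union z' X"
  using assms(2) unfolding fm_in_Union_def
proof (rule forces_ExE, unfold forces.simps(4))
  fix q h assume "q \<preceq> p" "q \<tturnstile> h \<^bold>\<in> X \<and> q \<tturnstile> z \<^bold>\<in> h"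
  then show "q \<tturnstile> \<^bold>\<exists>h. h \<^bold>\<in> X \<^bold>\<and> z' \<^bold>\<in> h"
    using mem_cong1 eq_mono[OF assms(1)]
    by (intro forces_ExI[where x = h]) (auto simp: forces.simps(4))
qed

lemma in_Union_subtree_cong:
  assumes "p \<tturnstile> z \<^bold>= z'" "p \<tturnstile> fm_in_Union_subtree z T t"
  shows "p \<tturnstile> fm_in_Union_subtree z' T t"
  using assms(2) unfolding fm_in_Union_subtree_def
proof (rule forces_ExE, unfold forces.simps(4))
  fix q s assume "q \<preceq> p" "q \<tturnstile> s \<^bold>\<in> T \<and> (q \<tturnstile> fm_subset s t \<^bold>\<or> fm_subset t s) \<and> q \<tturnstile> z \<^bold>\<in> s"
  then show "q \<tturnstile> \<^bold>\<exists>s. s \<^bold>\<in> T \<^bold>\<and> (fm_subset s t \<^bold>\<or> fm_subset t s) \<^bold>\<and> z' \<^bold>\<in> s"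
    using mem_cong1 eq_mono[OF assms(1)]
    by (intro forces_ExI[where x = s]) (auto simp: forces.simps(4))
qed

text \<open>Each single formula is decided by some stronger condition, and decisions persist, so
  finitely many of them can be made in succession.\<close>

lemma decide_finite:
  assumes "finite W" "p \<preceq> p"
  shows "\<exists>q. q \<preceq> p \<and> (\<forall>w\<in>W. (q \<tturnstile> \<phi> w) \<or> (q \<tturnstile> \<^bold>\<not> \<phi> w))"
  using assms(1)
proof (induction W)
  case empty
  then show ?case using assms(2) by blast
next
  case (insert w W)
  then obtain q where q: "q \<preceq> p" "\<And>w. w \<in> W \<Longrightarrow> (q \<tturnstile> \<phi> w) \<or> (q \<tturnstile> \<^bold>\<not> \<phi> w)" by blast
  obtain r where r: "r \<preceq> q" "(r \<tturnstile> \<phi> w) \<or> (r \<tturnstile> \<^bold>\<not> \<phi> w)"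
    using leq_refl(1)[OF q(1)] unfolding forces.simps(3) by blast
  have "(r \<tturnstile> \<phi> v) \<or> (r \<tturnstile> \<^bold>\<not> \<phi> v)" if "v \<in> W" for v
    using q(2)[OF that] forces_mono[OF _ r(1)] by blast
  then show ?case using q(1) r trans_Q by (intro exI[of _ r]) auto
qed

text \<open>The condition is strengthened to settle, in turn, a member of \<open>T\<close>
  containing \<open>z\<close>, whether it is included in \<open>t\<close> or includes it, the list
  that it is, and the position of \<open>z\<close> in that list.\<close>

lemma in_Union_subtreeD:
  assumes "p \<tturnstile> fm_tree check_omega T" "p \<preceq> p" "p \<tturnstile> fm_in_Union_subtree z T (check_seq t)"
  obtains q s k where "q \<preceq> p" "q \<tturnstile> check_seq s \<^bold>\<in> T" "prefix s t \<or> prefix t s" "k < length s"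
    "q \<tturnstile> z \<^bold>= opair (check_nat one k) (check_nat one (s ! k))"
proof -
  obtain q u where q: "q \<preceq> p" "q \<tturnstile> u \<^bold>\<in> T" "q \<tturnstile> fm_subset u (check_seq t) \<^bold>\<or> fm_subset (check_seq t) u" "q \<tturnstile> z \<^bold>\<in> u"
    using assms(2,3) unfolding fm_in_Union_subtree_def forces_Ex forces.simps(4) by blast
  obtain r where r: "r \<preceq> q" "(r \<tturnstile> fm_subset u (check_seq t)) \<or> (r \<tturnstile> fm_subset (check_seq t) u)"
    using q(3) leq_refl(1)[OF q(1)] unfolding forces_Or by blast
  have "r \<preceq> p" using q(1) r(1) trans_Q by blast
  obtain r1 s where r1: "r1 \<preceq> r" "r1 \<tturnstile> u \<^bold>= check_seq s" "r1 \<tturnstile> check_seq s \<^bold>\<in> T"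
    using tree_decide[OF forces_mono[OF assms(1) \<open>r \<preceq> p\<close>] forces_mono[OF q(2) r(1)] leq_refl(1)[OF r(1)]] .
  have refl: "r1 \<preceq> r1" using r1(1) by (rule leq_refl)
  have "(r1 \<tturnstile> fm_subset (check_seq s) (check_seq t)) \<or> (r1 \<tturnstile> fm_subset (check_seq t) (check_seq s))"
    using r(2) subset_cong[OF r1(2) eq_refl] subset_cong[OF eq_refl r1(2)] forces_mono[OF _ r1(1)] by metis
  then have pre: "prefix s t \<or> prefix t s"
    unfolding check_rel_subset[OF refl] graph_seq_subset .
  have "r1 \<preceq> q" using r(1) r1(1) trans_Q by blast
  then have "r1 \<tturnstile> z \<^bold>\<in> check_seq s" using mem_cong2[OF forces_mono[OF q(4)] r1(2)] by blast
  then obtain r2 k m where r2: "r2 \<preceq> r1" "(k, m) \<in> graph_seq s"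
      "r2 \<tturnstile> z \<^bold>= opair (check_nat one k) (check_nat one m)"
    by (rule is_check_obtain[OF is_check_check_rel _ refl]) auto
  have "r2 \<preceq> p" using r2(1) \<open>r1 \<preceq> q\<close> q(1) trans_Q by blast
  moreover have "k < length s" "m = s ! k" using r2(2) unfolding graph_seq_mem by simp_all
  ultimately show thesis
    using that[OF _ forces_mono[OF r1(3) r2(1)] pre] r2(3) by blast
qed

lemma in_Union_subtreeI:
  assumes "p \<tturnstile> check_seq s \<^bold>\<in> T" "prefix s t \<or> prefix t s" "k < length s" "p \<preceq> p"
  shows "p \<tturnstile> fm_in_Union_subtree (opair (check_nat one k) (check_nat one (s ! k))) T (check_seq t)"
  unfolding fm_in_Union_subtree_def
proof (rule forces_ExI[where x = "check_seq s"], unfold forces.simps(4), intro conjI)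
  show "p \<tturnstile> fm_subset (check_seq s) (check_seq t) \<^bold>\<or> fm_subset (check_seq t) (check_seq s)"
    using assms(2) by (intro forces_OrI) (simp add: check_rel_subset[OF assms(4)] graph_seq_subset)
  show "p \<tturnstile> opair (check_nat one k) (check_nat one (s ! k)) \<^bold>\<in> check_seq s"
    using assms(3) by (simp add: check_rel_mem[OF assms(4)] graph_seq_mem)
qed (rule assms(1))

text \<open>If the set were finite, some \<open>q\<close> below \<open>p\<close> would decide which of its elements lie in
  \<open>\<Union>T\<^sub>t - \<Union>X\<close>, and this difference would have the check name of a finite set.\<close>

lemma positive_tree_infinite:
  assumes pos: "p \<tturnstile> fm_positive_tree check_omega (check_family one P) T"
    and t: "p \<tturnstile> check_seq t \<^bold>\<in> T" and p: "p \<preceq> p" and X: "finite X" "X \<subseteq> P"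
  shows "infinite {z. \<exists>q s. q \<preceq> p \<and> (q \<tturnstile> check_seq s \<^bold>\<in> T) \<and> (prefix s t \<or> prefix t s) \<and>
    z \<in> graph_seq s - \<Union>(graph_fun ` X)}" (is "infinite ?W")
proof
  assume fin: "finite ?W"
  \<comment> \<open>Only membership in \<Union>\<open>T_t\<close> is left to decide: membership in
    \<Union>\<open>X\<close> is absolute, and \<open>?W\<close> already leaves out the pairs lying
    there.\<close>
  define \<psi> where "\<psi> = (\<lambda>(k, m). fm_in_Union_subtree (opair (check_nat one k) (check_nat one m)) T (check_seq t))"
  have tree: "p \<tturnstile> fm_tree check_omega T"
    using pos unfolding fm_positive_tree_def fm_injective_tree_def forces.simps(4) by blast
  obtain q where q: "q \<preceq> p" and dec: "\<And>w. w \<in> ?W \<Longrightarrow> (q \<tturnstile> \<psi> w) \<or> (q \<tturnstile> \<^bold>\<not> \<psi> w)"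
    using decide_finite[OF fin p, of \<psi>] by blast
  define D where "D = {w \<in> ?W. q \<tturnstile> \<psi> w}"
  have "q \<tturnstile> fm_finite check_omega (check_rel D)" unfolding check_rel_def
  proof (rule finite_check_set)
    show "finite ((\<lambda>(k, m). opair (check_nat one k) (check_nat one m)) ` D)"
      using fin unfolding D_def by simp
    fix a b r assume "a \<in> (\<lambda>(k, m). opair (check_nat one k) (check_nat one m)) ` D"
      "b \<in> (\<lambda>(k, m). opair (check_nat one k) (check_nat one m)) ` D" "r \<preceq> q" "r \<tturnstile> a \<^bold>= b"
    then show "a = b"
      by clarsimp (metis leq_refl(1) nat_eq_natD opair_injectD1 opair_injectD2)
  qed
  moreover have "q \<tturnstile> fm_finite check_omega (check_family one X)" unfolding check_family_def
  proof (rule finite_check_set)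
    fix a b r assume r: "r \<preceq> q" "r \<tturnstile> a \<^bold>= b"
      and "a \<in> check_fun one ` X" "b \<in> check_fun one ` X"
    then obtain f g where "a = check_rel (graph_fun f)" "b = check_rel (graph_fun g)"
      unfolding check_fun_eq by blast
    then show "a = b" using r check_rel_eq[OF leq_refl(1)[OF r(1)]] by simp
  qed (use X in simp)
  moreover have "q \<tturnstile> fm_subset (check_family one X) (check_family one P)"
    unfolding forced_subset_iff
  proof (intro allI impI, erule is_check_memE[OF is_check_family])
    fix z r a assume "a \<in> check_fun one ` X" "r \<tturnstile> z \<^bold>= a"
    then show "r \<tturnstile> z \<^bold>\<in> check_family one P"
      using X(2) is_check_memI[OF is_check_family] mem_cong1[OF _ eq_sym] by blast
  qed
  moreover have "q \<tturnstile> \<^bold>\<forall>z. z \<^bold>\<in> check_rel D \<^bold>\<longleftrightarrow>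
      (fm_in_Union_subtree z T (check_seq t) \<^bold>\<and> \<^bold>\<not> fm_in_Union z (check_family one X))"
    unfolding forces.simps(5) forces_Iff
  proof (intro allI impI iffI)
    fix z r assume "r \<preceq> q" "r \<tturnstile> z \<^bold>\<in> check_rel D"
    from this(2) show "r \<tturnstile> fm_in_Union_subtree z T (check_seq t) \<^bold>\<and> \<^bold>\<not> fm_in_Union z (check_family one X)"
    proof (rule check_rel_memE)
      fix r1 k m assume r1: "r1 \<preceq> r" "(k, m) \<in> D" "r1 \<tturnstile> z \<^bold>= opair (check_nat one k) (check_nat one m)"
      have "r1 \<preceq> q" using r1(1) \<open>r \<preceq> q\<close> trans_Q by blast
      then have "r1 \<tturnstile> \<psi> (k, m)" using r1(2) forces_mono unfolding D_def by blast
      then have "r1 \<tturnstile> fm_in_Union_subtree z T (check_seq t)"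
        unfolding \<psi>_def using in_Union_subtree_cong[OF eq_sym[OF r1(3)]] by simp
      moreover have "\<not> (r2 \<tturnstile> fm_in_Union z (check_family one X))" if "r2 \<preceq> r1" for r2
      proof
        assume "r2 \<tturnstile> fm_in_Union z (check_family one X)"
        then have "r2 \<tturnstile> fm_in_Union (opair (check_nat one k) (check_nat one m)) (check_family one X)"
          by (rule in_Union_cong[OF forces_mono[OF r1(3) that]])
        then have "(k, m) \<in> \<Union>(graph_fun ` X)" unfolding in_Union_iff[OF leq_refl(1)[OF that]] .
        then show False using r1(2) unfolding D_def by blast
      qed
      ultimately show "r1 \<tturnstile> fm_in_Union_subtree z T (check_seq t) \<^bold>\<and> \<^bold>\<not> fm_in_Union z (check_family one X)"
        unfolding forces.simps(3,4) by blast
    qed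
  next
    fix z r assume r: "r \<preceq> q"
      "r \<tturnstile> fm_in_Union_subtree z T (check_seq t) \<^bold>\<and> \<^bold>\<not> fm_in_Union z (check_family one X)"
    show "r \<tturnstile> z \<^bold>\<in> check_rel D"
    proof (rule forces_dense)
      fix r1 assume r1: "r1 \<preceq> r"
      then have r1p: "r1 \<preceq> p" using r(1) q trans_Q by blast
      have 1: "r1 \<tturnstile> fm_in_Union_subtree z T (check_seq t)"
        using forces_mono[OF r(2) r1] unfolding forces.simps(4) by blast
      obtain r2 s k where r2: "r2 \<preceq> r1" "r2 \<tturnstile> check_seq s \<^bold>\<in> T" "prefix s t \<or> prefix t s" "k < length s"
        "r2 \<tturnstile> z \<^bold>= opair (check_nat one k) (check_nat one (s ! k))"
        using in_Union_subtreeD[OF forces_mono[OF tree r1p] leq_refl(1)[OF r1] 1] .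
      have refl: "r2 \<preceq> r2" using r2(1) by (rule leq_refl)
      have r2r: "r2 \<preceq> r" using r2(1) r1 trans_Q by blast
      then have "\<not> (r2 \<tturnstile> fm_in_Union z (check_family one X))"
        using r(2) unfolding forces.simps(3,4) by blast
      then have "(k, s ! k) \<notin> \<Union>(graph_fun ` X)"
        using in_Union_iff[OF refl] in_Union_cong[OF eq_sym[OF r2(5)]] by blast
      moreover have "r2 \<preceq> p" using r2(1) r1p trans_Q by blast
      \<comment> \<open>\<open>?W\<close> collects everything that some condition below
        \<open>p\<close> can put into the difference, so it catches the value of \<open>z\<close>
        found at \<open>r2\<close>.\<close>
      ultimately have W: "(k, s ! k) \<in> ?W" using r2 graph_seq_mem by blast
      moreover have "r2 \<tturnstile> \<psi> (k, s ! k)"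
        unfolding \<psi>_def using in_Union_subtreeI[OF r2(2-4) refl] by simp
      moreover have "r2 \<preceq> q" using r2r r(1) trans_Q by blast
      \<comment> \<open>\<open>q\<close> decides \<psi> at this pair and cannot force its negation,
        since \<open>r2\<close> below \<open>q\<close> forces it.\<close>
      ultimately have "(k, s ! k) \<in> D" using dec[OF W] unfolding D_def forces.simps(3) by blast
      then have "r2 \<tturnstile> z \<^bold>\<in> check_rel D"
        using check_rel_mem[OF refl] mem_cong1[OF _ eq_sym[OF r2(5)]] by blast
      then show "\<exists>r'. r' \<preceq> r1 \<and> (r' \<tturnstile> z \<^bold>\<in> check_rel D)" using r2(1) by blast
    qed
  qed
  moreover have "q \<tturnstile> check_seq t \<^bold>\<in> T" using t q by (rule forces_mono)
  ultimately have "q \<tturnstile> \<^bold>\<exists>t. \<^bold>\<exists>X. \<^bold>\<exists>D. t \<^bold>\<in> T \<^bold>\<and> fm_finite check_omega X \<^bold>\<and> fm_subset X (check_family one P) \<^bold>\<and>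
      (\<^bold>\<forall>z. z \<^bold>\<in> D \<^bold>\<longleftrightarrow> (fm_in_Union_subtree z T t \<^bold>\<and> \<^bold>\<not> fm_in_Union z X)) \<^bold>\<and> fm_finite check_omega D"
    by (intro forces_ExI[where x = "check_seq t"] forces_ExI[where x = "check_family one X"]
          forces_ExI[where x = "check_rel D"]) (simp only: forces.simps(4) simp_thms)
  then show False using pos q unfolding fm_positive_tree_def forces.simps(3,4) by blast
qed

section \<open>Ground-model trees of possible elements\<close>

lemma positive_tree_tree: "p \<tturnstile> fm_positive_tree w P T \<Longrightarrow> p \<tturnstile> fm_tree w T"
  unfolding fm_positive_tree_def fm_injective_tree_def forces.simps(4) by blast

lemma positive_tree_distinct:
  assumes "p \<tturnstile> fm_positive_tree check_omega P T" "p \<tturnstile> check_seq t \<^bold>\<in> T" "p \<preceq> p"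
  shows "distinct t"
proof -
  have "p \<tturnstile> check_seq t \<^bold>\<in> T \<^bold>\<longrightarrow> fm_injective (check_seq t)"
    using assms(1) unfolding fm_positive_tree_def fm_injective_tree_def forces.simps(4,5) by blast
  from forces_ImpD[OF this assms(2)] show ?thesis by (rule check_seq_injectiveD[OF assms(3)])
qed


text \<open>\<open>r\<close> and \<open>c\<close> are separate arguments because \<open>c\<close>
  ranges over a countable set fixed for all names at once, and need not lie below
  \<open>r\<close>.\<close>

definition interp_tree :: "'p \<Rightarrow> 'p \<Rightarrow> ('i, 'p) name \<Rightarrow> nat list set" where
  "interp_tree r c T = {s. \<exists>q. q \<preceq> c \<and> q \<preceq> r \<and> (q \<tturnstile> check_seq s \<^bold>\<in> T)}"

text \<open>For a node \<open>t\<close>, pick \<open>q\<close> below \<open>r\<close> and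
  \<open>c\<close> forcing it into \<open>T\<close>. What is possible below \<open>q\<close> is also
  possible below \<open>r\<close> and \<open>c\<close>, so extensions of \<open>t\<close> and
  infinitely many pairs outside \<Union>\<open>X\<close> are found below this \<open>q\<close>. If
  \<open>r\<close> and \<open>c\<close> are incompatible, the set is empty, which counts as a
  positive tree.\<close>

lemma interp_tree_positive:
  assumes pos: "r \<tturnstile> fm_positive_tree check_omega (check_family one P) T"
  shows "interp_tree r c T \<in> positive_trees P"
proof -
  have 1: "s \<in> interp_tree r c T" if "t \<in> interp_tree r c T" "prefix s t" for s t
    using that tree_prefix[OF positive_tree_tree[OF forces_mono[OF pos]]]
    unfolding interp_tree_def by blast
  have 2: "\<exists>s\<in>interp_tree r c T. strict_prefix t s" if t: "t \<in> interp_tree r c T" for t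
  proof -
    obtain q where q: "q \<preceq> c" "q \<preceq> r" "q \<tturnstile> check_seq t \<^bold>\<in> T" using t unfolding interp_tree_def by blast
    obtain q' s where "q' \<preceq> q" "strict_prefix t s" "q' \<tturnstile> check_seq s \<^bold>\<in> T"
      using tree_extend[OF positive_tree_tree[OF forces_mono[OF pos q(2)]] q(3) leq_refl(1)[OF q(1)]] .
    then show ?thesis using q trans_Q unfolding interp_tree_def by blast
  qed
  have 3: "distinct t" if t: "t \<in> interp_tree r c T" for t
  proof -
    obtain q where q: "q \<preceq> c" "q \<preceq> r" "q \<tturnstile> check_seq t \<^bold>\<in> T" using t unfolding interp_tree_def by blast
    then show ?thesis
      using positive_tree_distinct[OF forces_mono[OF pos q(2)] q(3) leq_refl(1)[OF q(1)]] by blast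
  qed
  have 4: "infinite (\<Union>(graph_seq ` subtree_at (interp_tree r c T) t) - \<Union>(graph_fun ` X))"
    if t: "t \<in> interp_tree r c T" and X: "finite X" "X \<subseteq> P" for t X
  proof -
    obtain q where q: "q \<preceq> c" "q \<preceq> r" "q \<tturnstile> check_seq t \<^bold>\<in> T" using t unfolding interp_tree_def by blast
    have "{z. \<exists>q' s. q' \<preceq> q \<and> (q' \<tturnstile> check_seq s \<^bold>\<in> T) \<and> (prefix s t \<or> prefix t s) \<and>
        z \<in> graph_seq s - \<Union>(graph_fun ` X)}
      \<subseteq> \<Union>(graph_seq ` subtree_at (interp_tree r c T) t) - \<Union>(graph_fun ` X)"
      (is "?W \<subseteq> ?V")
    proof
      fix z assume "z \<in> ?W"
      then obtain q' s where q': "q' \<preceq> q" "q' \<tturnstile> check_seq s \<^bold>\<in> T" "prefix s t \<or> prefix t s"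
        "z \<in> graph_seq s - \<Union>(graph_fun ` X)" by blast
      then have "s \<in> interp_tree r c T" using q trans_Q unfolding interp_tree_def by blast
      then show "z \<in> ?V" using q'(3,4) unfolding subtree_at_def by blast
    qed
    then show ?thesis
      using positive_tree_infinite[OF forces_mono[OF pos q(2)] q(3) leq_refl(1)[OF q(1)] X]
        finite_subset by blast
  qed
  show ?thesis
    unfolding positive_trees_def injective_tree_def tree_def using 1 2 3 4 by blast
qed

text \<open>Needed because a member of \<open>F\<close> is only forced equal to one of the countably
  many chosen names.\<close>

lemma densely_diagonalizes_cong:
  assumes "p \<tturnstile> T \<^bold>= T'" "p \<tturnstile> fm_densely_diagonalizes g T"
  shows "p \<tturnstile> fm_densely_diagonalizes g T'"
  unfolding fm_densely_diagonalizes_def forces.simps(5)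
proof (intro allI forces_ImpI)
  fix t q assume q: "q \<preceq> p" "q \<tturnstile> t \<^bold>\<in> T'"
  let ?\<phi> = "\<lambda>s. fm_strict_ext t s \<^bold>\<and>
      (\<^bold>\<exists>k. \<^bold>\<exists>m. fm_pair_in k m s \<^bold>\<and> \<^bold>\<not> (\<^bold>\<exists>l. fm_pair_in k l t) \<^bold>\<and> fm_pair_in k m g)"
  have "q \<tturnstile> t \<^bold>\<in> T" using q mem_cong2 eq_sym[OF eq_mono[OF assms(1) q(1)]] by blast
  moreover have "q \<tturnstile> t \<^bold>\<in> T \<^bold>\<longrightarrow> (\<^bold>\<exists>s. s \<^bold>\<in> T \<^bold>\<and> ?\<phi> s)"
    using forces_mono[OF assms(2) q(1)] unfolding fm_densely_diagonalizes_def forces.simps(5) by blast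
  ultimately have "q \<tturnstile> \<^bold>\<exists>s. s \<^bold>\<in> T \<^bold>\<and> ?\<phi> s" using forces_ImpD by blast
  then show "q \<tturnstile> \<^bold>\<exists>s. s \<^bold>\<in> T' \<^bold>\<and> ?\<phi> s"
  proof (rule forces_ExE)
    fix r s assume r: "r \<preceq> q" "r \<tturnstile> s \<^bold>\<in> T \<^bold>\<and> ?\<phi> s"
    have "r \<tturnstile> s \<^bold>\<in> T'"
      using r mem_cong2 eq_mono[OF assms(1)] q(1) trans_Q unfolding forces.simps(4) by meson
    then show "r \<tturnstile> \<^bold>\<exists>s. s \<^bold>\<in> T' \<^bold>\<and> ?\<phi> s"
      using r(2) by (intro forces_ExI[where x = s]) (simp add: forces.simps(4))
  qed
qed

end

subsection \<open>Tightness in the extension\<close>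

text \<open>The second assumption says that a condition \<open>q\<close> is reflected by some \<open>c\<close> in a countable set:
  an open set from the family \<open>\<D>\<close> that \<open>c\<close> can be extended into can also be reached from \<open>q\<close>.\<close>

locale reflecting_forcing_notion = forcing_notion Q one enc
  for Q :: "'p rel" and one :: 'p and enc :: "(nat \<Rightarrow> nat) \<Rightarrow> 'i" +
  assumes countable_predense:
      "D \<subseteq> Field Q \<Longrightarrow> \<exists>A\<subseteq>D. countable A \<and> (\<forall>d\<in>D. \<exists>a\<in>A. \<exists>e. (e, d) \<in> Q \<and> (e, a) \<in> Q)"
    and countable_reflection:
      "countable \<D> \<Longrightarrow> (\<And>D d e. D \<in> \<D> \<Longrightarrow> d \<in> D \<Longrightarrow> (e, d) \<in> Q \<Longrightarrow> e \<in> D) \<Longrightarrow>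
       \<exists>C. countable C \<and> (\<forall>q\<in>Field Q. \<exists>c\<in>C. (q, c) \<in> Q \<and>
         (\<forall>D\<in>\<D>. (\<exists>d\<in>D. (d, c) \<in> Q) \<longrightarrow> (\<exists>d\<in>D. (d, q) \<in> Q)))"
begin

text \<open>Tightness is applied once, in the ground model, so \<open>g\<close> is fixed before any
  condition below some \<open>r\<close> is considered; hence the same \<open>g\<close> serves all
  pairs.\<close>

lemma diagonalize_countably_many:
  assumes "tight P" "countable S"
    and pos: "\<And>r T. (r, T) \<in> S \<Longrightarrow> r \<tturnstile> fm_positive_tree check_omega (check_family one P) T"
  shows "\<exists>g\<in>P. \<forall>(r, T)\<in>S. r \<tturnstile> fm_densely_diagonalizes (check_fun one g) T"
proof -
  \<comment> \<open>An open set for each name and list: \<open>s\<close> belongs to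
    \<open>interp_tree r c T\<close> exactly if \<open>c\<close> can be extended into
    \<open>E ((r, T), s)\<close>.\<close>
  define E where "E = (\<lambda>((r, T), s). {q. q \<preceq> r \<and> (q \<tturnstile> check_seq s \<^bold>\<in> T)})"
  have "countable (E ` (S \<times> (UNIV :: nat list set)))" using assms(2) by simp
  moreover have "e \<in> D" if D: "D \<in> E ` (S \<times> UNIV)" and d: "d \<in> D" and e: "e \<preceq> d" for D d e
  proof -
    obtain r T s where "D = E ((r, T), s)" using D by auto
    then have "D = {q. q \<preceq> r \<and> (q \<tturnstile> check_seq s \<^bold>\<in> T)}" unfolding E_def by simp
    then show ?thesis using d trans_Q[OF e] forces_mono[OF _ e] by simp
  qed
  ultimately have "\<exists>C. countable C \<and> (\<forall>q\<in>Field Q. \<exists>c\<in>C. q \<preceq> c \<and>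
      (\<forall>D\<in>E ` (S \<times> UNIV). (\<exists>d\<in>D. d \<preceq> c) \<longrightarrow> (\<exists>d\<in>D. d \<preceq> q)))"
    by (rule countable_reflection)
  then obtain C where C: "countable C" and reflect: "\<And>q. q \<in> Field Q \<Longrightarrow>
      \<exists>c\<in>C. q \<preceq> c \<and> (\<forall>D\<in>E ` (S \<times> UNIV). (\<exists>d\<in>D. d \<preceq> c) \<longrightarrow> (\<exists>d\<in>D. d \<preceq> q))"
    by blast
  define F where "F = (\<lambda>((r, T), c). interp_tree r c T) ` (S \<times> C)"
  have "countable F" unfolding F_def using assms(2) C by simp
  moreover have "F \<subseteq> positive_trees P" unfolding F_def using interp_tree_positive[OF pos] by auto
  ultimately have "\<exists>g\<in>P. \<forall>T\<in>F. densely_diagonalizes g T"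
    using assms(1) by (simp add: tight_def)
  then obtain g where g: "g \<in> P" "\<And>T. T \<in> F \<Longrightarrow> densely_diagonalizes g T" by blast
  have "r \<tturnstile> fm_densely_diagonalizes (check_fun one g) T" if rT: "(r, T) \<in> S" for r T
    unfolding fm_densely_diagonalizes_def forces.simps(5)
  proof (intro allI forces_ImpI, rule forces_dense)
    let ?\<phi> = "\<lambda>t s. s \<^bold>\<in> T \<^bold>\<and> fm_strict_ext t s \<^bold>\<and>
      (\<^bold>\<exists>k. \<^bold>\<exists>m. fm_pair_in k m s \<^bold>\<and> \<^bold>\<not> (\<^bold>\<exists>l. fm_pair_in k l t) \<^bold>\<and> fm_pair_in k m (check_fun one g))"
    fix t q q1 assume q: "q \<preceq> r" "q \<tturnstile> t \<^bold>\<in> T" "q1 \<preceq> q"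
    have q1r: "q1 \<preceq> r" using q trans_Q by blast
    obtain q2 s where q2: "q2 \<preceq> q1" "q2 \<tturnstile> t \<^bold>= check_seq s" "q2 \<tturnstile> check_seq s \<^bold>\<in> T"
      using tree_decide[OF positive_tree_tree[OF forces_mono[OF pos[OF rT] q1r]]
        forces_mono[OF q(2,3)] leq_refl(1)[OF q(3)]] .
    have q2r: "q2 \<preceq> r" using q2(1) q1r trans_Q by blast
    \<comment> \<open>\<open>c\<close> depends on \<open>q2\<close>, but \<open>F\<close> contains
      the tree of every member of \<open>C\<close>, so the \<open>g\<close> chosen before handles
      it.\<close>
    obtain c where c: "c \<in> C" "q2 \<preceq> c"
      and cE: "\<forall>D\<in>E ` (S \<times> UNIV). (\<exists>d\<in>D. d \<preceq> c) \<longrightarrow> (\<exists>d\<in>D. d \<preceq> q2)"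
      using reflect[OF FieldI1[OF q2(1)]] by blast
    have cD: "(\<exists>d\<in>E ((r, T), u). d \<preceq> c) \<longrightarrow> (\<exists>d\<in>E ((r, T), u). d \<preceq> q2)" for u
      by (rule bspec[OF cE]) (use rT in simp)
    have "s \<in> interp_tree r c T" unfolding interp_tree_def using c(2) q2r q2(3) by blast
    moreover have "densely_diagonalizes g (interp_tree r c T)"
    proof (rule g(2))
      show "interp_tree r c T \<in> F"
        unfolding F_def by (rule image_eqI[of _ _ "((r, T), c)"]) (use rT c(1) in simp_all)
    qed
    ultimately obtain u k where u: "u \<in> interp_tree r c T" "strict_prefix s u"
      "k < length u" "\<not> k < length s" "u ! k = g k"
      unfolding densely_diagonalizes_def by blast
    \<comment> \<open>That \<open>u\<close> is possible yields only a condition below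
      \<open>c\<close> forcing it into \<open>T\<close>; reflection provides one below
      \<open>q2\<close>.\<close>
    obtain d where d: "d \<preceq> q2" "d \<tturnstile> check_seq u \<^bold>\<in> T"
      using u(1) cD[of u] unfolding interp_tree_def E_def by auto
    have refl: "d \<preceq> d" using d(1) by (rule leq_refl)
    have ts: "d \<tturnstile> t \<^bold>= check_seq s" using q2(2) d(1) by (rule forces_mono)
    have "d \<tturnstile> fm_strict_ext t (check_seq u)"
      using strict_ext_cong[OF ts eq_refl] check_seq_strict_ext[OF refl] u(2) by blast
    \<comment> \<open>\<open>t\<close> equals \<open>check_seq s\<close> below \<open>d\<close>, so
      a value of \<open>t\<close> at \<open>k\<close> would be a pair in the graph of
      \<open>s\<close>, whose domain omits \<open>k\<close>.\<close>
    moreover have "d \<tturnstile> \<^bold>\<not> (\<^bold>\<exists>l. fm_pair_in (check_nat one k) l t)"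
      unfolding forces.simps(3)
    proof (intro allI impI notI)
      fix e assume e: "e \<preceq> d" "e \<tturnstile> \<^bold>\<exists>l. fm_pair_in (check_nat one k) l t"
      then obtain e1 l where e1: "e1 \<preceq> e" "e1 \<tturnstile> opair (check_nat one k) l \<^bold>\<in> t"
        unfolding forces_Ex fm_pair_in_iff using leq_refl(1) by blast
      have "e1 \<preceq> d" using e(1) e1(1) trans_Q by blast
      then have "e1 \<tturnstile> opair (check_nat one k) l \<^bold>\<in> check_seq s"
        using mem_cong2[OF e1(2) forces_mono[OF ts]] by blast
      then obtain e2 k' m where e2: "e2 \<preceq> e1" "(k', m) \<in> graph_seq s"
        "e2 \<tturnstile> opair (check_nat one k) l \<^bold>= opair (check_nat one k') (check_nat one m)"
        by (rule is_check_obtain[OF is_check_check_rel _ leq_refl(1)[OF e1(1)]]) auto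
      have "k = k'" using nat_eq_natD[OF leq_refl(1)[OF e2(1)] opair_injectD1[OF e2(3)]] .
      then show False using e2(2) u(4) by (simp add: graph_seq_mem)
    qed
    moreover have "d \<tturnstile> fm_pair_in (check_nat one k) (check_nat one (g k)) (check_seq u)"
      unfolding fm_pair_in_iff check_rel_mem[OF refl] graph_seq_mem using u(3,5) by simp
    moreover have "d \<tturnstile> fm_pair_in (check_nat one k) (check_nat one (g k)) (check_fun one g)"
      unfolding fm_pair_in_iff check_fun_eq check_rel_mem[OF refl] graph_fun_mem ..
    ultimately have "d \<tturnstile> ?\<phi> t (check_seq u)"
      unfolding forces.simps(4) using d(2)
      by (intro conjI forces_ExI[where x = "check_nat one k"] forces_ExI[where x = "check_nat one (g k)"])
        (simp_all only: forces.simps(4) simp_thms)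
    then have "d \<tturnstile> \<^bold>\<exists>s. ?\<phi> t s" by (rule forces_ExI)
    moreover have "d \<preceq> q1" using d(1) q2(1) trans_Q by blast
    ultimately show "\<exists>d. d \<preceq> q1 \<and> (d \<tturnstile> \<^bold>\<exists>s. ?\<phi> t s)" by blast
  qed
  then show ?thesis using g(1) by blast
qed

lemma forces_tight:
  assumes "tight P"
  shows "p \<tturnstile> fm_tight (check_family one P)"
  unfolding fm_tight_def
proof (rule forces_ExI[where x = check_omega], unfold forces.simps(4,5), intro conjI forces_omega allI forces_ImpI)
  fix F :: "('i, 'p) name" and q
  let ?P = "check_family one P"
  let ?\<psi> = "\<^bold>\<exists>g. g \<^bold>\<in> ?P \<^bold>\<and> (\<^bold>\<forall>T. T \<^bold>\<in> F \<^bold>\<longrightarrow> fm_densely_diagonalizes g T)"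
  assume "q \<tturnstile> fm_countable check_omega F \<^bold>\<and> (\<^bold>\<forall>T. T \<^bold>\<in> F \<^bold>\<longrightarrow> fm_positive_tree check_omega ?P T)"
  then have countable: "q \<tturnstile> fm_countable check_omega F"
    and pos: "q \<tturnstile> T \<^bold>\<in> F \<^bold>\<longrightarrow> fm_positive_tree check_omega ?P T" for T
    unfolding forces.simps(4,5) by blast+
  from countable show "q \<tturnstile> ?\<psi>" unfolding fm_countable_def
  proof (rule forces_ExE)
    fix r f assume "r \<preceq> q" "r \<tturnstile> fm_function f F check_omega \<^bold>\<and> fm_injective f"
    then have rq: "r \<preceq> q" and fn: "r \<tturnstile> fm_function f F check_omega" and inj: "r \<tturnstile> fm_injective f"
      unfolding forces.simps(4) by blast+
    define R where "R = (\<lambda>n d T. (d \<tturnstile> T \<^bold>\<in> F) \<and> (d \<tturnstile> opair T (check_nat one n) \<^bold>\<in> f))"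
    define D where "D = (\<lambda>n. {d. d \<preceq> r \<and> (\<exists>T. R n d T)})"
    \<comment> \<open>For each index \<open>n\<close>, countably many conditions suffice to name the
      tree with this index; different conditions may use different names.\<close>
    have "\<forall>n. \<exists>A\<subseteq>D n. countable A \<and> (\<forall>d\<in>D n. \<exists>a\<in>A. \<exists>e. e \<preceq> d \<and> e \<preceq> a)"
      unfolding D_def by (intro allI countable_predense) (auto intro: FieldI1)
    then obtain A where A: "\<And>n. A n \<subseteq> D n" "\<And>n. countable (A n)"
      "\<And>n d. d \<in> D n \<Longrightarrow> \<exists>a\<in>A n. \<exists>e. e \<preceq> d \<and> e \<preceq> a" by metis
    define \<tau> where "\<tau> = (\<lambda>n d. SOME T. R n d T)"
    have \<tau>: "R n d (\<tau> n d)" if "d \<in> A n" for n d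
      unfolding \<tau>_def by (rule someI_ex) (use that A(1) in \<open>auto simp: D_def\<close>)
    define S where "S = (\<Union>n. (\<lambda>d. (d, \<tau> n d)) ` A n)"
    have "countable S" unfolding S_def using A(2) by simp
    moreover have "d \<tturnstile> fm_positive_tree check_omega ?P T" if "(d, T) \<in> S" for d T
    proof -
      obtain n where "d \<in> A n" "T = \<tau> n d" using \<open>(d, T) \<in> S\<close> unfolding S_def by blast
      then have "d \<tturnstile> T \<^bold>\<in> F" "d \<preceq> q" using \<tau> A(1) trans_Q rq unfolding D_def R_def by blast+
      then show ?thesis using forces_ImpD[OF forces_mono[OF pos]] by blast
    qed
    ultimately have "\<exists>g\<in>P. \<forall>(d, T)\<in>S. d \<tturnstile> fm_densely_diagonalizes (check_fun one g) T"
      by (rule diagonalize_countably_many[OF assms])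
    then obtain g where "g \<in> P"
      and diag: "\<And>d T. (d, T) \<in> S \<Longrightarrow> d \<tturnstile> fm_densely_diagonalizes (check_fun one g) T"
      by blast
    show "r \<tturnstile> ?\<psi>"
    proof (rule forces_ExI[where x = "check_fun one g"], unfold forces.simps(4,5), intro conjI allI forces_ImpI)
      show "r \<tturnstile> check_fun one g \<^bold>\<in> ?P"
        using \<open>g \<in> P\<close> by (intro is_check_memI[OF is_check_family]) blast
      fix T s assume s: "s \<preceq> r" "s \<tturnstile> T \<^bold>\<in> F"
      from forces_mono[OF fn s(1)] s(2) show "s \<tturnstile> fm_densely_diagonalizes (check_fun one g) T"
      proof (rule function_valE)
        fix s1 y assume s1: "s1 \<preceq> s" "s1 \<tturnstile> opair T y \<^bold>\<in> f"
        have s1r: "s1 \<preceq> r" using s s1 trans_Q by blast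
        have "s1 \<tturnstile> y \<^bold>\<in> check_omega" using function_mem_codomain[OF forces_mono[OF fn s1r] s1(2)] .
        then show "s1 \<tturnstile> fm_densely_diagonalizes (check_fun one g) T"
        proof (rule is_check_memE[OF is_check_omega], elim imageE, intro forces_dense)
          fix s2 b n s3 assume s2: "s2 \<preceq> s1" "s2 \<tturnstile> y \<^bold>= b" "b = check_nat one n" "s3 \<preceq> s2"
          have s3s1: "s3 \<preceq> s1" using s2 trans_Q by blast
          then have s3s: "s3 \<preceq> s" using s1(1) trans_Q by blast
          then have s3r: "s3 \<preceq> r" using s(1) trans_Q by blast
          have "s3 \<tturnstile> y \<^bold>= check_nat one n" using forces_mono[OF s2(2,4)] s2(3) by simp
          then have s3n: "s3 \<tturnstile> opair T (check_nat one n) \<^bold>\<in> f"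
            using mem_cong1[OF forces_mono[OF s1(2) s3s1] opair_cong[OF eq_refl]] by blast
          then have "s3 \<in> D n"
            unfolding D_def R_def using s3r forces_mono[OF s(2) s3s] by blast
          then obtain a e where a: "a \<in> A n" "e \<preceq> s3" "e \<preceq> a" using A(3) by blast
          have "e \<tturnstile> opair (\<tau> n a) (check_nat one n) \<^bold>\<in> f"
            using \<tau>[OF a(1)] forces_mono[OF _ a(3)] unfolding R_def by blast
          moreover have "e \<tturnstile> fm_injective f" using forces_mono[OF inj] a(2) s3r trans_Q by blast
          \<comment> \<open>Both names have index \<open>n\<close> at \<open>e\<close>, so
            injectivity of \<open>f\<close> identifies \<open>T\<close> with the name attached to
            \<open>a\<close>, which \<open>g\<close> already diagonalizes.\<close>
          ultimately have "e \<tturnstile> \<tau> n a \<^bold>= T" using forces_mono[OF s3n a(2)] injectiveD by blast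
          moreover have "e \<tturnstile> fm_densely_diagonalizes (check_fun one g) (\<tau> n a)"
            using diag[of a "\<tau> n a"] a(1) forces_mono[OF _ a(3)] unfolding S_def by blast
          ultimately have "e \<tturnstile> fm_densely_diagonalizes (check_fun one g) T"
            by (rule densely_diagonalizes_cong)
          then show "\<exists>e. e \<preceq> s3 \<and> (e \<tturnstile> fm_densely_diagonalizes (check_fun one g) T)"
            using a(2) by blast
        qed
      qed
    qed
  qed
qed

end

subsection \<open>Cohen forcing\<close>

definition compatible :: "('a \<rightharpoonup> 'b) \<Rightarrow> ('a \<rightharpoonup> 'b) \<Rightarrow> bool" where
  "compatible p q \<longleftrightarrow> (\<forall>x\<in>dom p \<inter> dom q. p x = q x)"

text \<open>The second map prevails in \<open>p ++ q\<close>, so it is the inclusion of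
  \<open>p\<close> that depends on compatibility.\<close>

lemma compatible_le_map_add: "compatible p q \<Longrightarrow> p \<subseteq>\<^sub>m p ++ q"
  unfolding compatible_def map_le_def by (metis IntI map_add_dom_app_simps(1,3))

text \<open>A condition incompatible with \<open>p0\<close> takes the opposite value at some \<open>x \<in> dom p0\<close>. The
  conditions that do so at a fixed \<open>x\<close> agree there, so \<open>x\<close> may be deleted from their domains.\<close>

lemma finite_predense_bounded_card:
  fixes D :: "('a \<rightharpoonup> bool) set"
  assumes "\<And>p. p \<in> D \<Longrightarrow> finite (dom p) \<and> card (dom p) \<le> n"
  shows "\<exists>A\<subseteq>D. finite A \<and> (\<forall>p\<in>D. \<exists>a\<in>A. compatible p a)"
  using assms
proof (induction n arbitrary: D)
  case 0
  then have *: "compatible p q" if "p \<in> D" for p q using that unfolding compatible_def by fastforce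
  show ?case
  proof (cases "D = {}")
    case False
    then obtain q where "q \<in> D" by blast
    then show ?thesis using * by (intro exI[of _ "{q}"]) auto
  qed blast
next
  case (Suc n)
  show ?case
  proof (cases "D = {}")
    case False
    then obtain p0 where p0: "p0 \<in> D" by blast
    \<comment> \<open>Meant for \<open>x\<close> in \<open>dom p0\<close>. Elsewhere
      \<open>the (p0 x)\<close> is unspecified, but it is still one fixed value, so all members of
      \<open>B x\<close> agree at \<open>x\<close> and the next claim holds for every
      \<open>x\<close>.\<close>
    define B where "B = (\<lambda>x. {p \<in> D. p x = Some (\<not> the (p0 x))})"
    have "\<exists>A\<subseteq>B x. finite A \<and> (\<forall>p\<in>B x. \<exists>a\<in>A. compatible p a)" for x
    proof -
      have "\<exists>A\<subseteq>(\<lambda>p. p(x := None)) ` B x. finite A \<and>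
          (\<forall>p\<in>(\<lambda>p. p(x := None)) ` B x. \<exists>a\<in>A. compatible p a)"
      proof (rule Suc.IH)
        fix q assume "q \<in> (\<lambda>p. p(x := None)) ` B x"
        then obtain p where "p \<in> D" "x \<in> dom p" "q = p(x := None)" unfolding B_def by auto
        then show "finite (dom q) \<and> card (dom q) \<le> n" using Suc.prems[of p] by auto
      qed
      then obtain A' where A': "A' \<subseteq> (\<lambda>p. p(x := None)) ` B x" "finite A'"
        "\<forall>p\<in>(\<lambda>p. p(x := None)) ` B x. \<exists>a\<in>A'. compatible p a" by blast
      \<comment> \<open>\<open>A'\<close> consists of shortened maps; finitely many preimages in
        \<open>B x\<close> are chosen to represent them.\<close>
      obtain A where A: "A \<subseteq> B x" "finite A" "A' = (\<lambda>p. p(x := None)) ` A"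
        using finite_subset_image[OF A'(2,1)] by blast
      have A'': "\<exists>a\<in>A. compatible (p(x := None)) (a(x := None))" if "p \<in> B x" for p
        using A'(3) that unfolding A(3) by simp
      have "compatible p a"
        if pa: "p \<in> B x" "a \<in> A" and c: "compatible (p(x := None)) (a(x := None))" for p a
        unfolding compatible_def
      proof
        fix y assume y: "y \<in> dom p \<inter> dom a"
        have "p x = a x" using pa A(1) unfolding B_def by auto
        moreover have "p y = a y" if "y \<noteq> x"
          using bspec[OF c[unfolded compatible_def], of y] y that by simp
        ultimately show "p y = a y" by blast
      qed
      then have "\<forall>p\<in>B x. \<exists>a\<in>A. compatible p a" using A'' by blast
      then show ?thesis using A(1,2) by blast
    qed
    then obtain A where A: "\<And>x. A x \<subseteq> B x" "\<And>x. finite (A x)"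
      "\<And>x p. p \<in> B x \<Longrightarrow> \<exists>a\<in>A x. compatible p a" by metis
    have "\<exists>a\<in>insert p0 (\<Union>(A ` dom p0)). compatible p a" if "p \<in> D" for p
    proof (cases "compatible p p0")
      case False
      then obtain x where "x \<in> dom p0" "p \<in> B x"
        using \<open>p \<in> D\<close> unfolding compatible_def B_def by fastforce
      then show ?thesis using A(3) by blast
    qed blast
    moreover have "insert p0 (\<Union>(A ` dom p0)) \<subseteq> D" using p0 A(1) unfolding B_def by blast
    moreover have "finite (insert p0 (\<Union>(A ` dom p0)))" using Suc.prems[OF p0] A(2) by simp
    ultimately show ?thesis by blast
  qed blast
qed

text \<open>The countable chain condition in predense form: the maps are sorted by a bound on the
  size of their domains, and each bound contributes a finite set.\<close>

lemma countable_predense_finite_maps: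
  fixes D :: "('a \<rightharpoonup> bool) set"
  assumes "\<And>p. p \<in> D \<Longrightarrow> finite (dom p)"
  shows "\<exists>A\<subseteq>D. countable A \<and> (\<forall>p\<in>D. \<exists>a\<in>A. compatible p a)"
proof -
  let ?D = "\<lambda>n. {p \<in> D. card (dom p) \<le> n}"
  have "\<exists>A\<subseteq>?D n. finite A \<and> (\<forall>p\<in>?D n. \<exists>a\<in>A. compatible p a)" for n
    by (rule finite_predense_bounded_card) (use assms in auto)
  then have "\<forall>n. \<exists>A. A \<subseteq> ?D n \<and> finite A \<and> (\<forall>p\<in>?D n. \<exists>a\<in>A. compatible p a)" by blast
  from choice[OF this] obtain A where A: "\<And>n. A n \<subseteq> ?D n" "\<And>n. finite (A n)"
    "\<And>n. \<forall>p\<in>?D n. \<exists>a\<in>A n. compatible p a" by blast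
  have "(\<Union>n. A n) \<subseteq> D" using A(1) by blast
  moreover have "countable (\<Union>n. A n)" using A(2) by (simp add: countable_finite)
  moreover have "\<exists>a\<in>\<Union>n. A n. compatible p a" if "p \<in> D" for p
    using A(3)[of "card (dom p)"] that by blast
  ultimately show ?thesis by (intro exI[of _ "\<Union>n. A n"]) simp
qed

lemma countable_finite_maps:
  assumes "countable U"
  shows "countable {p :: 'a \<rightharpoonup> bool. finite (dom p) \<and> dom p \<subseteq> U}"
proof (rule countable_subset)
  \<comment> \<open>A finite map into \<open>bool\<close> is coded by its domain and the set where
    it is true, two finite subsets of \<open>U\<close>; \<open>?h\<close> decodes.\<close>
  let ?h = "\<lambda>(S, R) x. if x \<in> S then Some (x \<in> R) else None"
  show "{p :: 'a \<rightharpoonup> bool. finite (dom p) \<and> dom p \<subseteq> U}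
    \<subseteq> ?h ` ({S. finite S \<and> S \<subseteq> U} \<times> {S. finite S \<and> S \<subseteq> U})"
  proof
    fix p :: "'a \<rightharpoonup> bool" assume p: "p \<in> {p. finite (dom p) \<and> dom p \<subseteq> U}"
    have "{x. p x = Some True} \<subseteq> dom p" by auto
    then have "(dom p, {x. p x = Some True}) \<in> {S. finite S \<and> S \<subseteq> U} \<times> {S. finite S \<and> S \<subseteq> U}"
      using p finite_subset by auto
    moreover have "p = ?h (dom p, {x. p x = Some True})" by (auto simp: fun_eq_iff)
    ultimately show "p \<in> ?h ` ({S. finite S \<and> S \<subseteq> U} \<times> {S. finite S \<and> S \<subseteq> U})"
      by (rule rev_image_eqI)
  qed
  show "countable (?h ` ({S. finite S \<and> S \<subseteq> U} \<times> {S. finite S \<and> S \<subseteq> U}))"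
    using countable_Collect_finite_subset[OF assms] by (intro countable_image countable_SIGMA)
qed

lemma Field_Add_omega: "Field (Add_omega \<kappa>) = {p. cohen_condition \<kappa> p}"
  unfolding Field_def Add_omega_def by auto

lemma Add_omega_map_add:
  assumes "cohen_condition \<kappa> p" "cohen_condition \<kappa> q" "compatible p q"
  shows "(p ++ q, p) \<in> Add_omega \<kappa>" "(p ++ q, q) \<in> Add_omega \<kappa>"
  using assms compatible_le_map_add[OF assms(3)]
  unfolding Add_omega_def cohen_condition_def by auto

lemma compatible_Add_omega:
  assumes "(e, p) \<in> Add_omega \<kappa>" "(e, q) \<in> Add_omega \<kappa>"
  shows "compatible p q"
  using assms unfolding Add_omega_def compatible_def map_le_def by simp

lemma Add_omega_countable_predense:
  assumes "D \<subseteq> Field (Add_omega \<kappa>)"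
  shows "\<exists>A\<subseteq>D. countable A \<and>
    (\<forall>d\<in>D. \<exists>a\<in>A. \<exists>e. (e, d) \<in> Add_omega \<kappa> \<and> (e, a) \<in> Add_omega \<kappa>)"
proof -
  have D: "cohen_condition \<kappa> p" if "p \<in> D" for p using assms that Field_Add_omega by blast
  then obtain A where A: "A \<subseteq> D" "countable A" "\<forall>p\<in>D. \<exists>a\<in>A. compatible p a"
    using countable_predense_finite_maps[of D] unfolding cohen_condition_def by blast
  have "\<exists>a\<in>A. \<exists>e. (e, d) \<in> Add_omega \<kappa> \<and> (e, a) \<in> Add_omega \<kappa>" if d: "d \<in> D" for d
  proof -
    obtain a where a: "a \<in> A" "compatible d a" using A(3) d by blast
    then have "cohen_condition \<kappa> a" using D A(1) by blast
    then show ?thesis using Add_omega_map_add[OF D[OF d] _ a(2)] a(1) by blast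
  qed
  then show ?thesis using A(1,2) by blast
qed

text \<open>\<open>U\<close> is the union of the supports of countable predense sets
  \<open>A D\<close>, and \<open>c\<close> is \<open>q\<close> restricted to \<open>U\<close>. If
  \<open>c\<close> extends to some \<open>d\<close> in \<open>D\<close>, then some \<open>a\<close>
  in \<open>A D\<close> is compatible with \<open>d\<close>, hence with \<open>c\<close>. All
  coordinates of \<open>a\<close> lie in \<open>U\<close>, so \<open>a\<close> is compatible with
  \<open>q\<close> too, and \<open>a ++ q\<close> is in \<open>D\<close> because \<open>D\<close> is
  open.\<close>

lemma Add_omega_countable_reflection:
  assumes "countable \<D>"
    and opn: "\<And>D d e. D \<in> \<D> \<Longrightarrow> d \<in> D \<Longrightarrow> (e, d) \<in> Add_omega \<kappa> \<Longrightarrow> e \<in> D"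
  shows "\<exists>C. countable C \<and> (\<forall>q\<in>Field (Add_omega \<kappa>). \<exists>c\<in>C. (q, c) \<in> Add_omega \<kappa> \<and>
    (\<forall>D\<in>\<D>. (\<exists>d\<in>D. (d, c) \<in> Add_omega \<kappa>) \<longrightarrow> (\<exists>d\<in>D. (d, q) \<in> Add_omega \<kappa>)))"
proof -
  let ?Q = "Add_omega \<kappa>"
  \<comment> \<open>Members of the family need not consist of conditions, hence the intersection
    with \<open>Field ?Q\<close>.\<close>
  have "\<forall>D. \<exists>A\<subseteq>D \<inter> Field ?Q. countable A \<and>
      (\<forall>d\<in>D \<inter> Field ?Q. \<exists>a\<in>A. \<exists>e. (e, d) \<in> ?Q \<and> (e, a) \<in> ?Q)"
    by (intro allI Add_omega_countable_predense) blast
  then obtain A where A: "\<And>D. A D \<subseteq> D \<inter> Field ?Q" "\<And>D. countable (A D)"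
    "\<And>D. \<forall>d\<in>D \<inter> Field ?Q. \<exists>a\<in>A D. \<exists>e. (e, d) \<in> ?Q \<and> (e, a) \<in> ?Q" by metis
  define U where "U = (\<Union>D\<in>\<D>. \<Union>a\<in>A D. dom a)"
  have "countable (dom a)" if "a \<in> A D" for a D
    using that A(1) unfolding Field_Add_omega cohen_condition_def
    by (auto intro!: countable_finite)
  then have "countable U" unfolding U_def using assms(1) A(2) by (intro countable_UN) auto
  then have C: "countable {c :: _ \<rightharpoonup> bool. finite (dom c) \<and> dom c \<subseteq> U}"
    by (rule countable_finite_maps)
  have "\<exists>c\<in>{c. finite (dom c) \<and> dom c \<subseteq> U}. (q, c) \<in> ?Q \<and>
    (\<forall>D\<in>\<D>. (\<exists>d\<in>D. (d, c) \<in> ?Q) \<longrightarrow> (\<exists>d\<in>D. (d, q) \<in> ?Q))" if "q \<in> Field ?Q" for q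
  proof (rule bexI[of _ "q |` U"], intro conjI ballI impI)
    have q: "cohen_condition \<kappa> q" using that Field_Add_omega by blast
    show "q |` U \<in> {c. finite (dom c) \<and> dom c \<subseteq> U}"
      using q unfolding cohen_condition_def by simp
    show "(q, q |` U) \<in> ?Q"
      using q unfolding Add_omega_def cohen_condition_def map_le_def by auto
    fix D assume D: "D \<in> \<D>" "\<exists>d\<in>D. (d, q |` U) \<in> ?Q"
    then obtain d where d: "d \<in> D" "(d, q |` U) \<in> ?Q" by blast
    then have "d \<in> D \<inter> Field ?Q" using FieldI1[OF d(2)] by blast
    then obtain a e where a: "a \<in> A D" "(e, d) \<in> ?Q" "(e, a) \<in> ?Q" using A(3) by blast
    have "(e, q |` U) \<in> ?Q" using a(2) d(2) unfolding Add_omega_def by (auto intro: map_le_trans)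
    then have "compatible a (q |` U)" using a(3) compatible_Add_omega by blast
    moreover have "dom a \<subseteq> U" using a(1) D(1) unfolding U_def by blast
    ultimately have "compatible a q" unfolding compatible_def by auto
    moreover have "a \<in> D" "cohen_condition \<kappa> a" using a(1) A(1) Field_Add_omega by blast+
    ultimately show "\<exists>d\<in>D. (d, q) \<in> ?Q"
      using opn[OF D(1)] Add_omega_map_add[OF _ q] by blast
  qed
  then show ?thesis using C by blast
qed

text \<open>The injection of the reals into \<open>'i\<close> ensures that
  \<open>check_family\<close> has the intended elements; the result covers every index type this
  large, hence names of any such hereditary size.\<close>

theorem theorem5p5:
  fixes \<kappa> :: "'k rel" and P :: "(nat \<Rightarrow> nat) set"
  assumes "Card_order \<kappa>"
    and "eventually_different_permutations P"
    and "tight P"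
    and "\<exists>e :: (nat \<Rightarrow> nat) \<Rightarrow> 'i. inj e"
  shows "forced (Add_omega \<kappa>)
           (fm_tight (check_family Map.empty P :: ('i, 'k \<times> nat \<rightharpoonup> bool) name))"
proof -
  obtain enc :: "(nat \<Rightarrow> nat) \<Rightarrow> 'i" where "inj enc" using assms(4) by blast
  interpret reflecting_forcing_notion "Add_omega \<kappa>" Map.empty enc
  proof
    show "(p, p) \<in> Add_omega \<kappa>" "(p, Map.empty) \<in> Add_omega \<kappa>" if "p \<in> Field (Add_omega \<kappa>)" for p
      using that unfolding Field_Add_omega by (auto simp: Add_omega_def cohen_condition_def)
    show "(r, p) \<in> Add_omega \<kappa>" if "(r, q) \<in> Add_omega \<kappa>" "(q, p) \<in> Add_omega \<kappa>" for r q p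
      using that by (auto simp: Add_omega_def intro: map_le_trans)
  qed (fact \<open>inj enc\<close>, erule Add_omega_countable_predense,
      rule Add_omega_countable_reflection, assumption, blast)
  show ?thesis unfolding forced_def using forces_tight[OF assms(3)] by blast
qed

end
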